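(* Let $X,Y_1,Y_2$ be real separable Banach spaces and let $\mu$ be a Gaussian measure on $\mathcal{B}(X)$ with mean element $m_\mu$ and covariance operator $C_\mu:X^*\to X$. Let $G_1:X\to Y_1$ and $G_2:X\to Y_2$ be bounded linear operators. Suppose that both $C_{\nu_1}:=G_1C_\mu G_1^*$ and $C_{\nu_2}:=G_2C_\mu G_2^*$ have finite rank $p_1$ and $p_2$, respectively. Then $$\mu_{|(G_1,G_2)=(y_1,y_2)}=\left(\mu_{|G_1=y_1}\right)_{|G_2=y_2},$$ where the equality holds for almost all $(y_1,y_2)\in Y_1\bigoplus Y_2$ with respect to the pushforward measure $\mu\circ(G_1,G_2)^{-1}$ on $Y_1\bigoplus Y_2$.
   Context: For a Banach space $X$, $f\in X$, $g^*\in X^*$, write $\langle f,g^*\rangle=g^*(f)$. The operator $(G_1,G_2):X\to Y_1\bigoplus Y_2$ is $x\mapsto G_1(x)\bigoplus G_2(x)$; $Y_1\bigoplus Y_2$ carries any norm inducing the product topology. Banach spaces carry their Borel $\sigma$-algebras. A Gaussian measure on a separable Banach space is a Borel probability measure all of whose pushforwards by continuous linear functionals are Gaussian (possibly degenerate). Its mean element is the unique $m_\mu\in X$ with $\int_X\langle f,g^*\rangle d\mu(f)=\langle m_\mu,g^*\rangle$ for all $g^*\in X^*$; its covariance operator $C_\mu:X^*\to X$ satisfies $\langle C_\mu g_1^*,g_2^*\rangle=\int_X(\langle f,g_1^*\rangle-\langle m_\mu,g_1^*\rangle)(\langle f,g_2^*\rangle-\langle m_\mu,g_2^*\rangle)\,d\mu(f)$.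 Given a probability measure $\mu$ on $(X,\mathcal{A})$ and a measurable map $G:X\to(Y,\mathcal{C})$, a disintegration of $\mu$ with respect to $G$ is a map $\tilde\mu:\mathcal{A}\times Y\to[0,1]$, written $\mu_{|G=y}(\cdot):=\tilde\mu(\cdot,y)$, such that: (1) each $\tilde\mu(\cdot,y)$ is a probability measure and each $\tilde\mu(A,\cdot)$ is measurable; (2) there is a set in $\mathcal{C}$ of full $\mu\circ G^{-1}$-measure such that for all $y$ in it $\{y\}\in\mathcal{C}$ and $\tilde\mu(G^{-1}(\{y\}),y)=1$; (3) $\mu(A)=\int_Y\tilde\mu(A,y)\,d(\mu\circ G^{-1})(y)$ for all $A\in\mathcal{A}$. For a symmetric positive operator $R:Y^*\to Y$, a family $(y_i^* )_{i\in I}$ in $Y^*$ is $R$-representing if $\langle Ry_i^*,y_j^*\rangle=\delta_{ij}$ and $\sum_{i\in I}\langle Ry_i^*,y^*\rangle^2=\langle Ry^*,y^*\rangle$ for all $y^*\in Y^*$. When $\mu$ is Gaussian, $G:X\to Y$ is bounded linear and $GC_\mu G^*$ has finite rank $p$, $\mu_{|G=y}$ ($y\in Y$) denotes the disintegration consisting of the Gaussian measures with mean element $m_\mu+\sum_{i=1}^p\langle y-Gm_\mu,y_i^*\rangle C_\mu G^*y_i^*$ and covariance operator $C_\mu-\sum_{i=1}^p\langle C_\mu G^*y_i^*,\cdot\rangle C_\mu G^*y_i^*$, where $(y_i^* )_{i=1}^p$ is a $GC_\mu G^*$-representing sequence. The notation $(\mu_{|G_1=y_1})_{|G_2=y_2}$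 means this construction applied to the Gaussian measure $\mu_{|G_1=y_1}$ and the operator $G_2$; since the covariance operator of $\mu_{|G_1=y_1}$ does not depend on $y_1$, the same representing sequence is used for all $y_1$. *)

theory Defs
  imports "HOL-Probability.Probability"
begin

text \<open>The dual of \<^typ>\<open>'a\<close> is the type of bounded linear functionals \<open>'a \<Rightarrow>\<^sub>L real\<close>, the
  pairing \<open>\<langle>f, g\<rangle>\<close> is \<open>blinfun_apply g f\<close>, and the adjoint of \<open>G\<close> is \<open>\<lambda>g. g o\<^sub>L G\<close>.\<close>

lift_definition blinfun_pair ::
  "('a::real_normed_vector \<Rightarrow>\<^sub>L 'b::real_normed_vector) \<Rightarrow> ('a \<Rightarrow>\<^sub>L 'c::real_normed_vector) \<Rightarrow> 'a \<Rightarrow>\<^sub>L ('b \<times> 'c)"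
  is "\<lambda>G1 G2 x. (G1 x, G2 x)"
  by (rule bounded_linear_Pair)

text \<open>The first disjunct is the degenerate case.\<close>

definition gaussian_measure :: "'x::{banach,second_countable_topology} measure \<Rightarrow> bool" where
  "gaussian_measure \<mu> \<longleftrightarrow> sets \<mu> = sets borel \<and> prob_space \<mu> \<and>
     (\<forall>g :: 'x \<Rightarrow>\<^sub>L real. \<exists>a.
        distr \<mu> borel (blinfun_apply g) = return borel a \<or>
        (\<exists>\<sigma>>0. distr \<mu> borel (blinfun_apply g) = density lborel (\<lambda>t. ennreal (normal_density a \<sigma> t))))"

definition is_mean_element :: "'x::{banach,second_countable_topology} measure \<Rightarrow> 'x \<Rightarrow> bool" where
  "is_mean_element \<mu> m \<longleftrightarrow> (\<forall>g :: 'x \<Rightarrow>\<^sub>L real. (\<integral>f. g f \<partial>\<mu>) = g m)"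

definition mean_element :: "'x::{banach,second_countable_topology} measure \<Rightarrow> 'x" where
  "mean_element \<mu> = (THE m. is_mean_element \<mu> m)"

text \<open>Covariance operators are plain functions on the dual: the defining identity determines them
  pointwise and makes them linear.\<close>

definition is_covariance_operator ::
  "'x::{banach,second_countable_topology} measure \<Rightarrow> (('x \<Rightarrow>\<^sub>L real) \<Rightarrow> 'x) \<Rightarrow> bool" where
  "is_covariance_operator \<mu> C \<longleftrightarrow>
     (\<forall>g1 g2 :: 'x \<Rightarrow>\<^sub>L real. g2 (C g1) =
        (\<integral>f. (g1 f - g1 (mean_element \<mu>)) * (g2 f - g2 (mean_element \<mu>)) \<partial>\<mu>))"

definition covariance_operator ::
  "'x::{banach,second_countable_topology} measure \<Rightarrow> (('x \<Rightarrow>\<^sub>L real) \<Rightarrow> 'x)" where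
  "covariance_operator \<mu> = (THE C. is_covariance_operator \<mu> C)"

text \<open>The operator \<open>G C G\<^sup>*\<close>.\<close>

definition conj_operator ::
  "('x::real_normed_vector \<Rightarrow>\<^sub>L 'y::real_normed_vector) \<Rightarrow> (('x \<Rightarrow>\<^sub>L real) \<Rightarrow> 'x) \<Rightarrow> (('y \<Rightarrow>\<^sub>L real) \<Rightarrow> 'y)" where
  "conj_operator G C = (\<lambda>h. G (C (h o\<^sub>L G)))"

text \<open>The spanning condition is needed because \<open>dim\<close> is 0 in infinite dimension.\<close>

definition has_finite_rank :: "('a \<Rightarrow> 'b::real_vector) \<Rightarrow> nat \<Rightarrow> bool" where
  "has_finite_rank R p \<longleftrightarrow> (\<exists>B. finite B \<and> range R \<subseteq> span B) \<and> dim (range R) = p"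

definition representing ::
  "(('y::real_normed_vector \<Rightarrow>\<^sub>L real) \<Rightarrow> 'y) \<Rightarrow> 'i set \<Rightarrow> ('i \<Rightarrow> ('y \<Rightarrow>\<^sub>L real)) \<Rightarrow> bool" where
  "representing R I ys \<longleftrightarrow>
     (\<forall>i\<in>I. \<forall>j\<in>I. blinfun_apply (ys j) (R (ys i)) = (if i = j then 1 else 0)) \<and>
     (\<forall>h. ((\<lambda>i. (blinfun_apply h (R (ys i)))\<^sup>2) has_sum blinfun_apply h (R h)) I)"

definition disintegration :: "'x measure \<Rightarrow> 'y measure \<Rightarrow> ('x \<Rightarrow> 'y) \<Rightarrow> ('y \<Rightarrow> 'x measure) \<Rightarrow> bool" where
  "disintegration M N G K \<longleftrightarrow>
     (\<forall>y\<in>space N. sets (K y) = sets M \<and> prob_space (K y)) \<and>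
     (\<forall>A\<in>sets M. (\<lambda>y. measure (K y) A) \<in> borel_measurable N) \<and>
     (\<exists>S\<in>sets N. measure (distr M N G) S = 1 \<and>
        (\<forall>y\<in>S. {y} \<in> sets N \<and> measure (K y) (G -` {y} \<inter> space M) = 1)) \<and>
     (\<forall>A\<in>sets M. measure M A = (\<integral>y. measure (K y) A \<partial>distr M N G))"

text \<open>\<open>ys 0, \<dots>, ys (p - 1)\<close> is a \<open>G C\<^sub>\<mu> G\<^sup>*\<close>-representing sequence, where \<open>G C\<^sub>\<mu> G\<^sup>*\<close> has finite rank \<open>p\<close>.\<close>

definition representing_sequence ::
  "'x::{banach,second_countable_topology} measure \<Rightarrow> ('x \<Rightarrow>\<^sub>L 'y::{banach,second_countable_topology}) \<Rightarrow>
   nat \<Rightarrow> (nat \<Rightarrow> ('y \<Rightarrow>\<^sub>L real)) \<Rightarrow> bool" where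
  "representing_sequence \<mu> G p ys \<longleftrightarrow>
     has_finite_rank (conj_operator G (covariance_operator \<mu>)) p \<and>
     representing (conj_operator G (covariance_operator \<mu>)) {..<p} ys"

text \<open>\<open>conditional \<mu> G p ys y\<close> is \<open>\<mu>\<^bsub>|G = y\<^esub>\<close>, built from the representing sequence \<open>ys\<close> of length \<open>p\<close>.\<close>

definition conditional ::
  "'x::{banach,second_countable_topology} measure \<Rightarrow> ('x \<Rightarrow>\<^sub>L 'y::{banach,second_countable_topology}) \<Rightarrow>
   nat \<Rightarrow> (nat \<Rightarrow> ('y \<Rightarrow>\<^sub>L real)) \<Rightarrow> 'y \<Rightarrow> 'x measure" where
  "conditional \<mu> G p ys =
     (let m = mean_element \<mu>; C = covariance_operator \<mu> in
      THE K. disintegration \<mu> borel (blinfun_apply G) K \<and>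
        (\<forall>y. gaussian_measure (K y) \<and>
             is_mean_element (K y) (m + (\<Sum>i<p. ys i (y - G m) *\<^sub>R C (ys i o\<^sub>L G))) \<and>
             is_covariance_operator (K y)
               (\<lambda>g. C g - (\<Sum>i<p. g (C (ys i o\<^sub>L G)) *\<^sub>R C (ys i o\<^sub>L G)))))"

end

theory Submission
  imports Defs
begin

text \<open>
  Conditioning a Gaussian vector \<open>x\<close> on an observation \<open>y = G x\<close> is a linear regression. Call a bounded
  operator \<open>L\<close> a gain if \<open>L G C G\<^sup>* = C G\<^sup>*\<close>. Then the residual \<open>x - L (G x)\<close> is uncorrelated with
  \<open>G x\<close>, hence independent of it, and the conditional law given \<open>G x = y\<close> is the law of
  \<open>x + L (y - G x)\<close> under \<open>\<mu>\<close>; this is \<open>posterior \<mu> G L y\<close>. The operator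
  \<open>y \<mapsto> \<Sum>i. y\<^sub>i\<^sup>*(y) C G\<^sup>* y\<^sub>i\<^sup>*\<close> given by a representing sequence is a gain, and the measures that
  define \<open>conditional\<close> are the corresponding posterior measures (\<open>conditional_eq_posterior\<close>).

  With gains the theorem becomes an algebraic identity. Two successive updates, by \<open>L1\<close> for \<open>G1\<close> and
  then by \<open>L2\<close> for \<open>G2\<close> and the reduced covariance \<open>C - L1 G1 C\<close>, compose to one update for the pair
  \<open>(G1, G2)\<close> (\<open>posterior_posterior\<close>) with the operator
  \<open>L (y1, y2) = L1 y1 + L2 (y2 - G2 (L1 y1))\<close>, and this operator is again a gain
  (\<open>is_gain_sequential_gain\<close>). The representing sequence of the pair provides another gain. Two gains
  agree on the range of \<open>G C G\<^sup>*\<close>, so their difference applied to \<open>G x - G m\<close> has covariance zero and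
  vanishes almost surely; this is the equality for almost every \<open>(y1, y2)\<close> (\<open>AE_posterior_eq\<close>).

  Two general facts are needed. A Gaussian measure on a separable Banach space is determined by its
  mean element and covariance operator (\<open>gaussian_unique\<close>); this makes the definition of
  \<open>conditional\<close> meaningful and gives the mixture property of the disintegration, since the law of
  \<open>x' + L (G x - G x')\<close> for independent copies \<open>x, x'\<close> has the same characteristic functional as \<open>\<mu>\<close>.
  It rests on the injectivity of the characteristic functional (\<open>measure_eq_if_char_functional_eq\<close>)
  and, to have enough functionals, on the Hahn-Banach theorem (\<open>norming_functional\<close>). Moreover, every
  finite-rank covariance operator has a representing sequence whose length is the rank
  (\<open>exists_representing\<close>), by taking an orthonormal family of maximal length.
\<close>

section \<open>Norming functionals\<close>

definition sublinear :: "('a::real_vector \<Rightarrow> real) \<Rightarrow> bool" where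
  "sublinear p \<longleftrightarrow> (\<forall>x y. p (x + y) \<le> p x + p y) \<and> (\<forall>c\<ge>0. \<forall>x. p (c *\<^sub>R x) = c * p x)"

lemma sublinear_add: "sublinear p \<Longrightarrow> p (x + y) \<le> p x + p y"
  and sublinear_scale: "sublinear p \<Longrightarrow> 0 \<le> c \<Longrightarrow> p (c *\<^sub>R x) = c * p x"
  by (auto simp: sublinear_def)

lemma sublinear_zero: "sublinear p \<Longrightarrow> p 0 = 0"
  using sublinear_scale[of p 0 0] by simp

lemma sublinear_lower: "sublinear p \<Longrightarrow> - p (- x) \<le> p x"
  using sublinear_add[of p x "- x"] sublinear_zero[of p] by simp

lemma sublinearI:
  assumes add: "\<And>x y. p (x + y) \<le> p x + p y"
    and scale: "\<And>c x. 0 < c \<Longrightarrow> p (c *\<^sub>R x) \<le> c * p x" and zero: "p 0 = 0"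
  shows "sublinear p"
proof -
  have "p (c *\<^sub>R x) = c * p x" if "0 < c" for c x
  proof (rule antisym)
    show "p (c *\<^sub>R x) \<le> c * p x" by (rule scale[OF that])
    have "p ((1/c) *\<^sub>R (c *\<^sub>R x)) \<le> (1/c) * p (c *\<^sub>R x)" using that by (intro scale) auto
    then show "c * p x \<le> p (c *\<^sub>R x)" using that by (simp add: field_simps)
  qed
  then have "p (c *\<^sub>R x) = c * p x" if "0 \<le> c" for c x
    using that zero by (cases "c = 0") auto
  then show ?thesis using add by (auto simp: sublinear_def)
qed

text \<open>For \<open>y\<close> fixed this is the pointwise greatest sublinear functional below \<open>p\<close> that takes the value
\<open>- p y\<close> at \<open>- y\<close>: it makes the functional additive in the direction \<open>y\<close>. It serves twice, to
show that a minimal sublinear functional is linear, and to prescribe the value of a linear functional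
at one point.\<close>

definition slide :: "('a::real_vector \<Rightarrow> real) \<Rightarrow> 'a \<Rightarrow> 'a \<Rightarrow> real" where
  "slide p y x = (INF t\<in>{0..}. p (x + t *\<^sub>R y) - t * p y)"

lemma slide_bounded:
  assumes "sublinear p" "0 \<le> t"
  shows "- p (- x) \<le> p (x + t *\<^sub>R y) - t * p y"
  using sublinear_add[OF assms(1), of "x + t *\<^sub>R y" "- x"] sublinear_scale[OF assms] by simp

lemma slide_le:
  assumes "sublinear p" "0 \<le> t"
  shows "slide p y x \<le> p (x + t *\<^sub>R y) - t * p y"
  unfolding slide_def using assms slide_bounded[OF assms(1)]
  by (intro cINF_lower) (auto intro!: bdd_belowI2)

lemma slide_greatest:
  "(\<And>t. 0 \<le> t \<Longrightarrow> c \<le> p (x + t *\<^sub>R y) - t * p y) \<Longrightarrow> c \<le> slide p y x"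
  unfolding slide_def by (intro cINF_greatest) auto

lemma slide_le_self: "sublinear p \<Longrightarrow> slide p y x \<le> p x"
  using slide_le[of p 0 y x] by simp

lemma sublinear_slide:
  assumes p: "sublinear p"
  shows "sublinear (slide p y)"
proof (rule sublinearI)
  fix x x'
  have *: "slide p y (x + x') - (p (x + s *\<^sub>R y) - s * p y) \<le> p (x' + t *\<^sub>R y) - t * p y"
    if "0 \<le> s" "0 \<le> t" for s t
  proof -
    have "slide p y (x + x') \<le> p ((x + s *\<^sub>R y) + (x' + t *\<^sub>R y)) - (s + t) * p y"
      using slide_le[OF p, of "s + t" y "x + x'"] that by (simp add: algebra_simps)
    then show ?thesis
      using sublinear_add[OF p, of "x + s *\<^sub>R y" "x' + t *\<^sub>R y"] by (simp add: algebra_simps)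
  qed
  have "slide p y (x + x') - (p (x + s *\<^sub>R y) - s * p y) \<le> slide p y x'" if "0 \<le> s" for s
    by (rule slide_greatest) (rule *[OF that])
  then have "slide p y (x + x') - slide p y x' \<le> p (x + s *\<^sub>R y) - s * p y" if "0 \<le> s" for s
    using that by (simp add: algebra_simps)
  from slide_greatest[of "slide p y (x + x') - slide p y x'" p x y, OF this]
  show "slide p y (x + x') \<le> slide p y x + slide p y x'" by simp
next
  fix c :: real and x assume c: "0 < c"
  have "slide p y (c *\<^sub>R x) / c \<le> slide p y x"
  proof (rule slide_greatest)
    fix t :: real assume "0 \<le> t"
    then have "slide p y (c *\<^sub>R x) \<le> p (c *\<^sub>R (x + t *\<^sub>R y)) - (c * t) * p y"
      using slide_le[OF p, of "c * t" y "c *\<^sub>R x"] c by (simp add: scaleR_add_right)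
    also have "\<dots> = c * (p (x + t *\<^sub>R y) - t * p y)"
      using sublinear_scale[OF p, of c "x + t *\<^sub>R y"] c by (simp add: right_diff_distrib)
    finally show "slide p y (c *\<^sub>R x) / c \<le> p (x + t *\<^sub>R y) - t * p y"
      using c by (simp add: field_simps)
  qed
  then show "slide p y (c *\<^sub>R x) \<le> c * slide p y x" using c by (simp add: field_simps)
next
  show "slide p y 0 = 0"
    using slide_le_self[OF p, of y 0] slide_greatest[of 0 p 0 y] slide_bounded[OF p, of _ 0 y]
    by (simp add: sublinear_zero[OF p])
qed

text \<open>The Hahn-Banach theorem in a form without subspaces. The infimum of a chain of sublinear functionals
below \<open>p\<close> is again one, because all of them stay above \<open>- p (- x)\<close>; so Zorn's lemma gives a minimal
one. A minimal \<open>q\<close> equals each of its slides, and \<open>q x \<le> q (x + y) - q y\<close> is the missing half of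
additivity.\<close>

lemma exists_linear_below_sublinear:
  assumes p: "sublinear p"
  shows "\<exists>f. linear f \<and> (\<forall>x. f x \<le> p x)"
proof -
  define Q where "Q = {q. sublinear q \<and> (\<forall>x. q x \<le> p x)}"
  define below where "below = (\<lambda>q r :: 'a \<Rightarrow> real. \<forall>x. r x \<le> q x)"
  have "\<exists>q\<in>Q. \<forall>r\<in>Q. below q r \<longrightarrow> r = q"
  proof (rule predicate_Zorn)
    show "partial_order_on Q (relation_of below Q)"
      by (rule partial_order_on_relation_ofI)
        (auto simp: below_def intro!: ext intro: order_trans order_antisym)
  next
    fix K assume K: "K \<in> Chains (relation_of below Q)"
    then have KQ: "K \<subseteq> Q" and tot: "\<And>q r. q \<in> K \<Longrightarrow> r \<in> K \<Longrightarrow> below q r \<or> below r q"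
      by (auto simp: Chains_def relation_of_def)
    show "\<exists>u\<in>Q. \<forall>q\<in>K. below q u"
    proof (cases "K = {}")
      case True
      then show ?thesis using p by (auto simp: Q_def)
    next
      case ne: False
      define u where "u = (\<lambda>x. INF q\<in>K. q x)"
      have subK: "sublinear q" and leK: "q x \<le> p x" if "q \<in> K" for q x
        using that KQ by (auto simp: Q_def)
      have "- p (- x) \<le> q x" if "q \<in> K" for q x
        using sublinear_lower[OF subK[OF that], of x] leK[OF that, of "- x"] by simp
      then have bdd: "bdd_below ((\<lambda>q. q x) ` K)" for x
        by (intro bdd_belowI2)
      have u_le: "u x \<le> q x" if "q \<in> K" for q x
        unfolding u_def by (rule cINF_lower[OF bdd that])
      have u_ge: "c \<le> u x" if "\<And>q. q \<in> K \<Longrightarrow> c \<le> q x" for c x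
        unfolding u_def using ne that by (intro cINF_greatest) auto
      have "sublinear u"
      proof (rule sublinearI)
        fix x y
        \<comment> \<open>Any two members are comparable, so both can be replaced by the smaller one, which is subadditive.\<close>
        have *: "u (x + y) - q x \<le> r y" if q: "q \<in> K" and r: "r \<in> K" for q r
          using tot[OF q r]
        proof
          assume "below q r"
          then show ?thesis
            using u_le[OF r, of "x + y"] sublinear_add[OF subK[OF r], of x y]
            unfolding below_def by (smt (verit))
        next
          assume "below r q"
          then show ?thesis
            using u_le[OF q, of "x + y"] sublinear_add[OF subK[OF q], of x y]
            unfolding below_def by (smt (verit))
        qed
        have "u (x + y) - u y \<le> q x" if "q \<in> K" for q
          using u_ge[of "u (x + y) - q x" y] *[OF that] by simp
        then show "u (x + y) \<le> u x + u y" using u_ge[of "u (x + y) - u y" x] by simp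
      next
        fix c :: real and x assume c: "0 < c"
        have "u (c *\<^sub>R x) / c \<le> q x" if "q \<in> K" for q
          using u_le[OF that, of "c *\<^sub>R x"] sublinear_scale[OF subK[OF that], of c x] c
          by (simp add: field_simps)
        then have "u (c *\<^sub>R x) / c \<le> u x" by (rule u_ge)
        then show "u (c *\<^sub>R x) \<le> c * u x" using c by (simp add: field_simps)
      next
        have "(\<lambda>q. q 0) ` K = {0}" using ne subK by (auto simp: sublinear_zero image_iff)
        then show "u 0 = 0" unfolding u_def by simp
      qed
      moreover have "u x \<le> p x" for x
        using ne u_le leK by (meson all_not_in_conv order_trans)
      ultimately show ?thesis using u_le by (auto simp: Q_def below_def intro!: bexI[of _ u])
    qed
  qed
  then obtain q where q: "sublinear q" "\<And>x. q x \<le> p x"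
    and minimal: "\<And>r. sublinear r \<Longrightarrow> (\<And>x. r x \<le> q x) \<Longrightarrow> r = q"
    unfolding Q_def below_def by (auto) (meson order_trans)
  have slide_q: "slide q y = q" for y
    by (rule minimal[OF sublinear_slide[OF q(1)] slide_le_self[OF q(1)]])
  have add: "q (x + y) = q x + q y" for x y
    using slide_le[OF q(1), of 1 y x] sublinear_add[OF q(1), of x y] by (simp add: slide_q)
  have neg: "q (- x) = - q x" for x
    using add[of x "- x"] by (simp add: sublinear_zero[OF q(1)])
  have "q (c *\<^sub>R x) = c *\<^sub>R q x" for c x
  proof (cases "0 \<le> c")
    case False
    then have "q ((- c) *\<^sub>R x) = (- c) * q x" by (intro sublinear_scale[OF q(1)]) auto
    then show ?thesis using neg[of "c *\<^sub>R x"] by simp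
  qed (simp add: sublinear_scale[OF q(1)])
  then have "linear q" using add by (intro linearI)
  with q(2) show ?thesis by blast
qed

text \<open>Sliding the norm along \<open>a\<close> lowers its value at \<open>- a\<close> to \<open>- norm a\<close>; a linear functional below that
is bounded by the norm and reaches \<open>norm a\<close> at \<open>a\<close>.\<close>

lemma norming_functional:
  fixes a :: "'a::real_normed_vector"
  obtains g :: "'a \<Rightarrow>\<^sub>L real" where "\<And>x. g x \<le> norm x" "g a = norm a"
proof -
  have norm: "sublinear (norm :: 'a \<Rightarrow> real)" by (auto simp: sublinear_def norm_triangle_ineq)
  obtain f where f: "linear f" "\<And>x. f x \<le> slide norm a x"
    using exists_linear_below_sublinear[OF sublinear_slide[OF norm, of a]] by blast
  have le: "f x \<le> norm x" for x
    using f(2)[of x] slide_le_self[OF norm, of a x] by simp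
  have abs_le: "\<bar>f x\<bar> \<le> norm x" for x
    using le[of x] le[of "- x"] by (simp add: linear_neg[OF f(1)])
  have bl: "bounded_linear f"
    using f(1) abs_le by (auto simp: bounded_linear_def bounded_linear_axioms_def intro!: exI[of _ 1])
  have "f (- a) \<le> - norm a"
    using f(2)[of "- a"] slide_le[OF norm, of 1 a "- a"] by simp
  then have "f a = norm a" using le[of a] by (simp add: linear_neg[OF f(1)])
  then show thesis
    using that[of "Blinfun f"] le by (simp add: bounded_linear_Blinfun_apply[OF bl])
qed

lemma eq_if_functionals_eq:
  fixes x y :: "'a::real_normed_vector"
  assumes "\<And>g :: 'a \<Rightarrow>\<^sub>L real. g x = g y"
  shows "x = y"
proof -
  obtain g :: "'a \<Rightarrow>\<^sub>L real" where "g (x - y) = norm (x - y)" by (rule norming_functional[of "x - y"])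
  then show ?thesis using assms[of g] by (simp add: blinfun.diff_right)
qed

text \<open>Norming functionals of the points of a countable dense set suffice: if \<open>d\<close> is close to \<open>x\<close>, the
functional that norms \<open>d\<close> almost norms \<open>x\<close>. Countability is what allows null sets and
\<open>\<sigma>\<close>-algebras to be treated one functional at a time.\<close>

lemma norming_sequence:
  obtains f :: "nat \<Rightarrow> ('a::{real_normed_vector,second_countable_topology} \<Rightarrow>\<^sub>L real)"
  where "\<And>x r. norm x \<le> r \<longleftrightarrow> (\<forall>n. f n x \<le> r)"
proof -
  obtain D :: "'a set" where D: "countable D" "\<And>U. open U \<Longrightarrow> U \<noteq> {} \<Longrightarrow> \<exists>d\<in>D. d \<in> U"
    using countable_dense_setE by metis
  have "D \<noteq> {}" using D(2)[of UNIV] by auto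
  have "\<forall>a :: 'a. \<exists>g :: 'a \<Rightarrow>\<^sub>L real. (\<forall>x. g x \<le> norm x) \<and> g a = norm a"
    by (metis norming_functional)
  then obtain g :: "'a \<Rightarrow> ('a \<Rightarrow>\<^sub>L real)" where g: "\<And>a x. g a x \<le> norm x" "\<And>a. g a a = norm a"
    by metis
  have "norm x \<le> r" if "\<And>n. g (from_nat_into D n) x \<le> r" for x r
  proof (rule ccontr)
    assume "\<not> norm x \<le> r"
    then obtain d where d: "d \<in> D" "d \<in> ball x ((norm x - r) / 2)"
      using D(2)[of "ball x ((norm x - r) / 2)"] by auto
    obtain n where "d = from_nat_into D n" using d(1) D(1) by (metis from_nat_into_surj)
    then have "g d x \<le> r" using that by simp
    moreover have "norm d - g d x \<le> norm (d - x)"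
      using g(1)[of d "d - x"] g(2)[of d] by (simp add: blinfun.diff_right)
    moreover have "2 * norm (d - x) < norm x - r" using d(2) by (simp add: dist_norm norm_minus_commute)
    moreover have "norm x \<le> norm d + norm (d - x)" by norm
    ultimately show False by simp
  qed
  then show thesis
    using that[of "\<lambda>n. g (from_nat_into D n)"] g(1) by (meson order_trans)
qed

section \<open>Cylinder sets\<close>

text \<open>Cylinder sets are built up by cutting with one functional at a time, because characteristic
functionals restricted to cylinder sets are compared by induction over the cuts.\<close>

inductive_set cylinders :: "'a::real_normed_vector set set" where
  whole: "UNIV \<in> cylinders"
| cut: "A \<in> cylinders \<Longrightarrow> (B :: real set) \<in> sets borel \<Longrightarrow> A \<inter> blinfun_apply h -` B \<in> cylinders"

lemma cylinders_Int: "A \<in> cylinders \<Longrightarrow> A' \<in> cylinders \<Longrightarrow> A \<inter> A' \<in> cylinders"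
proof (induction rule: cylinders.induct)
  case (cut A B h)
  then have "(A \<inter> A') \<inter> blinfun_apply h -` B \<in> cylinders" by (intro cylinders.cut)
  then show ?case by (simp add: Int_ac)
qed simp

lemma borel_measurable_blinfun_apply [measurable]: "blinfun_apply h \<in> borel_measurable borel"
  by (intro borel_measurable_continuous_onI continuous_intros)

lemma cylinders_borel: "A \<in> cylinders \<Longrightarrow> A \<in> sets borel"
  by (induction rule: cylinders.induct) (auto intro: measurable_sets_borel)

text \<open>A closed ball is a countable intersection of half-spaces, by means of a norming sequence, and an open
set is a countable union of closed balls.\<close>

lemma sigma_sets_cylinders:
  "sigma_sets UNIV cylinders = (sets borel :: 'a::{real_normed_vector,second_countable_topology} set set)"
proof (rule antisym)
  show "sigma_sets UNIV cylinders \<subseteq> (sets borel :: 'a set set)"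
    using sets.sigma_sets_subset[of cylinders "borel :: 'a measure"] cylinders_borel by auto
  interpret S: sigma_algebra UNIV "sigma_sets UNIV (cylinders :: 'a set set)"
    by (rule sigma_algebra_sigma_sets) auto
  obtain f :: "nat \<Rightarrow> ('a \<Rightarrow>\<^sub>L real)" where f: "\<And>x r. norm x \<le> r \<longleftrightarrow> (\<forall>n. f n x \<le> r)"
    by (rule norming_sequence) auto
  have ball: "cball c r \<in> sigma_sets UNIV cylinders" for c :: 'a and r
  proof -
    have "cball c r = (\<Inter>n. blinfun_apply (f n) -` {.. r + f n c})"
      by (auto simp: dist_norm norm_minus_commute[of c] f blinfun.diff_right algebra_simps)
    also have "\<dots> \<in> sigma_sets UNIV cylinders"
    proof (rule S.countable_INT'')
      fix n
      have "UNIV \<inter> blinfun_apply (f n) -` {.. r + f n c} \<in> cylinders"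
        by (intro cylinders.cut cylinders.whole) simp
      then show "blinfun_apply (f n) -` {.. r + f n c} \<in> sigma_sets UNIV cylinders"
        by simp
    qed auto
    finally show ?thesis .
  qed
  obtain D :: "'a set" where D: "countable D" "\<And>U. open U \<Longrightarrow> U \<noteq> {} \<Longrightarrow> \<exists>d\<in>D. d \<in> U"
    using countable_dense_setE by metis
  have "U \<in> sigma_sets UNIV cylinders" if "open U" for U :: "'a set"
  proof -
    define I where "I = {(d, n :: nat). d \<in> D \<and> cball d (1 / Suc n) \<subseteq> U}"
    have "\<exists>i\<in>I. x \<in> cball (fst i) (1 / Suc (snd i))" if x: "x \<in> U" for x
    proof -
      obtain e where e: "0 < e" "ball x e \<subseteq> U" using \<open>open U\<close> x by (meson open_contains_ball)
      obtain n :: nat where n: "1 / Suc n < e / 2" using nat_approx_posE[of "e / 2"] e(1) by auto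
      obtain d where d: "d \<in> D" "d \<in> ball x (1 / Suc n)" using D(2)[of "ball x (1 / Suc n)"] by auto
      have "cball d (1 / Suc n) \<subseteq> ball x e"
      proof
        fix y assume "y \<in> cball d (1 / Suc n)"
        then show "y \<in> ball x e"
          using dist_triangle[of x y d] d(2) n by (simp del: of_nat_Suc)
      qed
      then show ?thesis using d e(2) by (intro bexI[of _ "(d, n)"]) (auto simp: I_def dist_commute)
    qed
    then have "U = (\<Union>i\<in>I. cball (fst i) (1 / Suc (snd i)))" by (fastforce simp: I_def)
    moreover have "countable I"
      by (rule countable_subset[of _ "D \<times> UNIV"]) (use D(1) in \<open>auto simp: I_def\<close>)
    ultimately show ?thesis using ball S.countable_UN'[of I] by auto
  qed
  then have "sigma_sets UNIV {S :: 'a set. open S} \<subseteq> sigma_sets UNIV cylinders"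
    by (intro S.sigma_sets_subset) auto
  then show "(sets borel :: 'a set set) \<subseteq> sigma_sets UNIV cylinders"
    by (simp add: borel_def)
qed

section \<open>Characteristic functionals determine measures\<close>

lemma char_eq_cis: "char M t = (\<integral>x. cis (t * x) \<partial>M)"
  by (simp add: char_def cis_conv_exp)

lemma borel_measurable_cis [measurable]: "cis \<in> borel_measurable borel"
  by (intro borel_measurable_continuous_onI continuous_intros)

lemma integrable_cis:
  assumes "finite_measure M" "f \<in> borel_measurable M"
  shows "integrable M (\<lambda>x. cis (f x))"
proof -
  interpret finite_measure M by (rule assms)
  show ?thesis using assms(2) by (intro integrable_const_bound[of _ 1]) auto
qed

text \<open>The value of the characteristic function at \<open>0\<close> is the total mass, so both measures can be normalised
by the same constant.\<close>

lemma Levy_uniqueness_finite: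
  fixes M N :: "real measure"
  assumes fin: "finite_measure M" "finite_measure N"
    and sets: "sets M = sets borel" "sets N = sets borel"
    and char: "\<And>t. char M t = char N t"
  shows "M = N"
proof -
  interpret M: finite_measure M by (rule fin)
  interpret N: finite_measure N by (rule fin)
  have space: "space M = UNIV" "space N = UNIV" using sets by (auto dest: sets_eq_imp_space_eq)
  define c where "c = measure M UNIV"
  have "complex_of_real (measure M UNIV) = complex_of_real (measure N UNIV)"
    using char[of 0] by (simp add: char_def space scaleR_conv_of_real)
  then have c_N: "measure N UNIV = c" by (simp add: c_def)
  have em: "emeasure M UNIV = ennreal c" "emeasure N UNIV = ennreal c"
    using c_N by (simp_all add: c_def M.emeasure_eq_measure N.emeasure_eq_measure)
  show ?thesis
  proof (cases "c = 0")
    case True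
    have "emeasure M A = 0" "emeasure N A = 0" for A
      using em True emeasure_space[of M A] emeasure_space[of N A] by (auto simp: space)
    then show ?thesis using sets by (intro measure_eqI) auto
  next
    case False
    then have c: "c > 0" by (simp add: c_def less_le)
    have dist: "real_distribution (density L (\<lambda>_. ennreal (1 / c)))"
      if "sets L = sets borel" "space L = UNIV" "emeasure L UNIV = ennreal c" for L :: "real measure"
    proof -
      have "prob_space (density L (\<lambda>_. ennreal (1 / c)))"
        using that c by (intro prob_spaceI)
          (simp add: emeasure_density_const flip: ennreal_mult' ennreal_mult'')
      then show ?thesis using that by (simp add: real_distribution_def real_distribution_axioms_def)
    qed
    have "char (density L (\<lambda>_. ennreal (1 / c))) t = char L t / c" if "sets L = sets borel" for L t
    proof -
      have "(\<lambda>x. cis (t * x)) \<in> borel_measurable L"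
        by (subst measurable_cong_sets[OF that refl]) measurable
      then show ?thesis
        using c by (simp add: char_eq_cis integral_density scaleR_conv_of_real)
    qed
    then have "density M (\<lambda>_. ennreal (1 / c)) = density N (\<lambda>_. ennreal (1 / c))"
      using sets space em char by (intro Levy_uniqueness dist) auto
    moreover have "emeasure L A = ennreal c * emeasure (density L (\<lambda>_. ennreal (1 / c))) A"
      if "A \<in> sets L" for L :: "real measure" and A
      using that c by (simp add: emeasure_density_const mult.assoc[symmetric] flip: ennreal_mult')
    ultimately show ?thesis using sets by (intro measure_eqI) (metis sets_eq_imp_space_eq)+
  qed
qed

text \<open>Uniqueness on the line, applied to the images under \<open>h\<close> of the measures with density \<open>w\<close>.\<close>

lemma Levy_uniqueness_weighted:
  fixes w :: "'a \<Rightarrow> real" and h :: "'a \<Rightarrow> real"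
  assumes fin: "finite_measure M" "finite_measure N" and sets: "sets M = sets N"
    and [measurable]: "w \<in> borel_measurable M" "h \<in> borel_measurable M" "B \<in> sets borel"
    and w: "\<And>x. 0 \<le> w x" "\<And>x. w x \<le> c"
    and eq: "\<And>t. (\<integral>x. w x *\<^sub>R cis (t * h x) \<partial>M) = (\<integral>x. w x *\<^sub>R cis (t * h x) \<partial>N)"
  shows "(\<integral>x. indicator B (h x) * w x \<partial>M) = (\<integral>x. indicator B (h x) * w x \<partial>N)"
proof -
  define weighted where "weighted = (\<lambda>L. distr (density L (\<lambda>x. ennreal (w x))) borel h)"
  have weighted: "finite_measure (weighted L)" "char (weighted L) t = (\<integral>x. w x *\<^sub>R cis (t * h x) \<partial>L)"
    "measure (weighted L) B = (\<integral>x. indicator B (h x) * w x \<partial>L)"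
    if L: "finite_measure L" "sets L = sets M" for L t
  proof -
    interpret L: finite_measure L by (rule L)
    have [measurable]: "w \<in> borel_measurable L" "h \<in> borel_measurable L"
      using assms(4,5) by (simp_all cong: measurable_cong_sets add: L(2))
    have int: "integrable L w" using w by (intro L.integrable_const_bound[of _ c]) auto
    show "finite_measure (weighted L)"
      using int w(1) unfolding weighted_def
      by (intro finite_measure.finite_measure_distr finite_measureI)
        (auto simp: emeasure_density nn_integral_eq_integral cong: nn_integral_cong)
    show "char (weighted L) t = (\<integral>x. w x *\<^sub>R cis (t * h x) \<partial>L)"
      using w(1) by (simp add: weighted_def char_eq_cis integral_distr integral_density)
    have "measure (weighted L) B = (\<integral>y. indicator B y \<partial>weighted L)"
      by (simp add: weighted_def)
    also have "\<dots> = (\<integral>x. w x *\<^sub>R indicator B (h x) \<partial>L)"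
      using w(1) unfolding weighted_def by (subst integral_distr) (auto simp: integral_density)
    finally show "measure (weighted L) B = (\<integral>x. indicator B (h x) * w x \<partial>L)"
      by (simp add: mult.commute)
  qed
  have "weighted M = weighted N"
    using weighted fin sets eq by (intro Levy_uniqueness_finite) (auto simp: weighted_def)
  then show ?thesis using weighted(3) fin sets by metis
qed

text \<open>One step in the passage from the line to many dimensions: equality of the characteristic functionals
on \<open>A\<close> survives a further cut by \<open>h\<close>. The weight \<open>cis (g x)\<close> is complex, while uniqueness on the
line concerns positive measures; therefore it is applied with the nonnegative weights \<open>1 + cos (g x + a)\<close>
on \<open>A\<close>. Taking \<open>g = 0\<close> removes the summand \<open>1\<close>, and \<open>a = 0\<close>, \<open>a = - pi / 2\<close> recover the real
and the imaginary part of \<open>cis (g x)\<close>.\<close>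

lemma char_functional_cut:
  fixes M N :: "'a::real_normed_vector measure" and g h :: "'a \<Rightarrow>\<^sub>L real"
  assumes fin: "finite_measure M" "finite_measure N" and sets: "sets M = sets borel" "sets N = sets borel"
    and A: "A \<in> sets borel" and B: "B \<in> sets borel"
    and eq: "\<And>g :: 'a \<Rightarrow>\<^sub>L real. (\<integral>x. indicator A x *\<^sub>R cis (g x) \<partial>M) = (\<integral>x. indicator A x *\<^sub>R cis (g x) \<partial>N)"
  shows "(\<integral>x. indicator (A \<inter> blinfun_apply h -` B) x *\<^sub>R cis (g x) \<partial>M)
       = (\<integral>x. indicator (A \<inter> blinfun_apply h -` B) x *\<^sub>R cis (g x) \<partial>N)"
proof -
  note [measurable] = A B
  let ?I = "\<lambda>x. indicator B (h x) * indicator A x :: real"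
  have borelI: "f \<in> borel_measurable L"
    if "f \<in> borel_measurable borel" "sets L = sets borel" for L and f :: "'a \<Rightarrow> 'b::topological_space"
    using that by (simp cong: measurable_cong_sets)
  have int_cis: "integrable L (\<lambda>x. indicator A x *\<^sub>R cis (k x))"
    if "finite_measure L" "sets L = sets borel" for L and k :: "'a \<Rightarrow>\<^sub>L real"
  proof (rule integrable_mult_indicator)
    show "A \<in> sets L" using A that(2) by simp
    show "integrable L (\<lambda>x. cis (k x))" by (rule integrable_cis[OF that(1) borelI[OF _ that(2)]]) simp
  qed
  have int: "integrable L (\<lambda>x. ?I x * u x)"
    if "finite_measure L" "sets L = sets borel" and [measurable]: "u \<in> borel_measurable borel"
      and u: "\<And>x. \<bar>u x\<bar> \<le> 1" for L u
  proof (rule finite_measure.integrable_const_bound[OF that(1), of _ 1])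
    show "AE x in L. norm (?I x * u x) \<le> 1" using u by (simp add: indicator_def)
    show "(\<lambda>x. ?I x * u x) \<in> borel_measurable L" by (rule borelI[OF _ that(2)]) measurable
  qed
  have trig: "(\<integral>x. ?I x * (1 + cos (g x + a)) \<partial>M) = (\<integral>x. ?I x * (1 + cos (g x + a)) \<partial>N)" for g :: "'a \<Rightarrow>\<^sub>L real" and a
  proof -
    have "(\<integral>x. indicator B (h x) * (indicator A x * (1 + cos (g x + a))) \<partial>M)
        = (\<integral>x. indicator B (h x) * (indicator A x * (1 + cos (g x + a))) \<partial>N)"
    proof (rule Levy_uniqueness_weighted[OF fin, where c = 2])
      show "(\<lambda>x. indicator A x * (1 + cos (g x + a))) \<in> borel_measurable M" by (rule borelI) (use sets in auto)
      show "blinfun_apply h \<in> borel_measurable M" by (rule borelI) (use sets in auto)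
      fix x
      show "0 \<le> indicator A x * (1 + cos (g x + a))"
        using cos_ge_minus_one[of "g x + a"] by (intro mult_nonneg_nonneg) (simp, linarith)
      show "indicator A x * (1 + cos (g x + a)) \<le> 2" by (simp add: indicator_def)
    next
      fix t
      \<comment> \<open>The weight is a combination of three exponentials, so the hypothesis applies to the functionals
        \<open>t h\<close>, \<open>t h + g\<close> and \<open>t h - g\<close>.\<close>
      have expand: "(indicator A x * (1 + cos (g x + a))) *\<^sub>R cis (t * h x)
          = indicator A x *\<^sub>R cis ((t *\<^sub>R h) x)
            + ((cis a / 2) * (indicator A x *\<^sub>R cis ((t *\<^sub>R h + g) x))
            + (cis (- a) / 2) * (indicator A x *\<^sub>R cis ((t *\<^sub>R h - g) x)))" for x
      proof -
        have cos_cis: "complex_of_real (cos r) = (cis r + cis (- r)) / 2" for r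
          by (simp add: complex_eq_iff)
        have "complex_of_real (cos (g x + a)) = (cis (g x + a) + cis (- (g x + a))) / 2"
          by (rule cos_cis)
        also have "\<dots> = (cis a * cis (g x) + cis (- a) * cis (- g x)) / 2"
          by (simp add: cis_mult add.commute)
        finally have cos: "complex_of_real (cos (g x + a)) = \<dots>" .
        have cis: "cis ((t *\<^sub>R h) x) = cis (t * h x)"
          "cis ((t *\<^sub>R h + g) x) = cis (t * h x) * cis (g x)"
          "cis ((t *\<^sub>R h - g) x) = cis (t * h x) * cis (- g x)"
          by (simp_all add: blinfun.add_left blinfun.diff_left blinfun.scaleR_left cis_mult)
        show ?thesis
          unfolding cis scaleR_conv_of_real of_real_mult of_real_add of_real_1 cos
          by (simp add: field_simps)
      qed
      show "(\<integral>x. (indicator A x * (1 + cos (g x + a))) *\<^sub>R cis (t * h x) \<partial>M)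
          = (\<integral>x. (indicator A x * (1 + cos (g x + a))) *\<^sub>R cis (t * h x) \<partial>N)"
        unfolding expand
        by (simp only: Bochner_Integration.integral_add Bochner_Integration.integrable_add
          integrable_mult_right integral_mult_right_zero int_cis fin sets eq)
    qed (use sets B in auto)
    then show ?thesis by (simp add: mult.assoc)
  qed
  have cos_eq: "(\<integral>x. ?I x * cos (g x + a) \<partial>M) = (\<integral>x. ?I x * cos (g x + a) \<partial>N)" for g :: "'a \<Rightarrow>\<^sub>L real" and a
  proof -
    have "(\<integral>x. ?I x * (1 + cos (k x + b)) \<partial>L) = (\<integral>x. ?I x * 1 \<partial>L) + (\<integral>x. ?I x * cos (k x + b) \<partial>L)"
      if "finite_measure L" "sets L = sets borel" for L b and k :: "'a \<Rightarrow>\<^sub>L real"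
      unfolding distrib_left using that by (intro Bochner_Integration.integral_add int) auto
    note * = this[OF fin(1) sets(1)] this[OF fin(2) sets(2)]
    have "(\<integral>x. ?I x * 1 \<partial>M) = (\<integral>x. ?I x * 1 \<partial>N)"
      using trig[of 0 0] by simp
    then show ?thesis using trig[of g a] unfolding * by simp
  qed
  have "(\<integral>x. indicator (A \<inter> blinfun_apply h -` B) x *\<^sub>R cis (g x) \<partial>L)
      = complex_of_real (\<integral>x. ?I x * cos (g x + 0) \<partial>L) + \<i> * complex_of_real (\<integral>x. ?I x * cos (g x + (- pi / 2)) \<partial>L)"
    if "finite_measure L" "sets L = sets borel" for L
  proof -
    have "cos (r + (- pi / 2)) = sin r" for r unfolding cos_add by simp
    then have split: "indicator (A \<inter> blinfun_apply h -` B) x *\<^sub>R cis (g x)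
        = complex_of_real (?I x * cos (g x + 0)) + \<i> * complex_of_real (?I x * cos (g x + (- pi / 2)))" for x
      by (auto simp: complex_eq_iff indicator_def)
    have "integrable L (\<lambda>x. ?I x * cos (g x + a))" for a by (rule int[OF that]) auto
    then have "integrable L (\<lambda>x. complex_of_real (?I x * cos (g x + a)))" for a
      by (rule integrable_of_real)
    then show ?thesis
      unfolding split by (simp only: Bochner_Integration.integral_add integrable_mult_right
        integral_mult_right_zero integral_complex_of_real)
  qed
  from this[OF fin(1) sets(1)] this[OF fin(2) sets(2)] show ?thesis by (simp only: cos_eq)
qed

text \<open>A finite Borel measure is determined by its one-dimensional images: the characteristic functionals
agree on all cylinder sets, and \<open>g = 0\<close> gives the measures of these sets.\<close>

theorem measure_eq_if_char_functional_eq: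
  fixes M N :: "'a::{real_normed_vector,second_countable_topology} measure"
  assumes fin: "finite_measure M" "finite_measure N" and sets: "sets M = sets borel" "sets N = sets borel"
    and eq: "\<And>g :: 'a \<Rightarrow>\<^sub>L real. (\<integral>x. cis (g x) \<partial>M) = (\<integral>x. cis (g x) \<partial>N)"
  shows "M = N"
proof -
  interpret M: finite_measure M by (rule fin)
  interpret N: finite_measure N by (rule fin)
  have char: "(\<integral>x. indicator A x *\<^sub>R cis (g x) \<partial>M) = (\<integral>x. indicator A x *\<^sub>R cis (g x) \<partial>N)"
    if "A \<in> cylinders" for A and g :: "'a \<Rightarrow>\<^sub>L real"
    using that
  proof (induction arbitrary: g rule: cylinders.induct)
    case whole
    then show ?case using eq by simp
  next
    case (cut A B h)
    show ?case
      by (rule char_functional_cut[OF fin sets cylinders_borel[OF cut.hyps(1)] cut.hyps(2) cut.IH])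
  qed
  show ?thesis
  proof (rule measure_eqI_generator_eq[where E = cylinders and \<Omega> = UNIV and A = "\<lambda>_. UNIV"])
    show "Int_stable (cylinders :: 'a set set)" by (auto simp: Int_stable_def cylinders_Int)
    fix A :: "'a set" assume A: "A \<in> cylinders"
    have "complex_of_real (measure L A) = (\<integral>x. indicator A x *\<^sub>R cis ((0 :: 'a \<Rightarrow>\<^sub>L real) x) \<partial>L)"
      if "sets L = sets borel" for L
      using cylinders_borel[OF A] that sets_eq_imp_space_eq[OF that] by (simp add: scaleR_conv_of_real)
    from this[OF sets(1)] this[OF sets(2)] char[OF A, of 0]
    have "complex_of_real (measure M A) = complex_of_real (measure N A)" by simp
    then show "emeasure M A = emeasure N A"
      by (simp add: M.emeasure_eq_measure N.emeasure_eq_measure)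
  qed (use sets sigma_sets_cylinders[where 'a = 'a] cylinders.whole in auto)
qed

section \<open>Gaussian measures\<close>

text \<open>The law \<open>return borel a\<close> is the normal law of variance zero.\<close>

definition normal_law :: "real measure \<Rightarrow> bool" where
  "normal_law N \<longleftrightarrow> (\<exists>a. N = return borel a \<or>
     (\<exists>\<sigma>>0. N = density lborel (\<lambda>t. ennreal (normal_density a \<sigma> t))))"

lemma gaussian_measure_iff:
  "gaussian_measure \<mu> \<longleftrightarrow> sets \<mu> = sets borel \<and> prob_space \<mu> \<and>
    (\<forall>g. normal_law (distr \<mu> borel (blinfun_apply g)))"
  by (simp add: gaussian_measure_def normal_law_def)

text \<open>With the characteristic function written in terms of mean and variance, degenerate and nondegenerate laws
need no distinction from here on.\<close>

lemma normal_law_moments: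
  assumes "normal_law N"
  shows "integrable N (\<lambda>x. x)"
    and "integrable N (\<lambda>x. (x - (\<integral>x. x \<partial>N))\<^sup>2)"
    and "(\<integral>x. cis x \<partial>N) = cis (\<integral>x. x \<partial>N) * of_real (exp (- (\<integral>x. (x - (\<integral>x. x \<partial>N))\<^sup>2 \<partial>N) / 2))"
proof -
  have "integrable N (\<lambda>x. x) \<and> integrable N (\<lambda>x. (x - (\<integral>x. x \<partial>N))\<^sup>2) \<and>
    (\<integral>x. cis x \<partial>N) = cis (\<integral>x. x \<partial>N) * of_real (exp (- (\<integral>x. (x - (\<integral>x. x \<partial>N))\<^sup>2 \<partial>N) / 2))"
    using assms unfolding normal_law_def
  proof (elim exE disjE conjE)
    fix a assume N: "N = return borel a"
    have integrable: "integrable (return borel a) f" if "f \<in> borel_measurable borel" for f :: "real \<Rightarrow> real"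
    proof (rule finite_measure.integrable_const_bound)
      show "finite_measure (return borel a)" by (rule prob_space.finite_measure) (simp add: prob_space_return)
      show "AE x in return borel a. norm (f x) \<le> norm (f a)" using that by (subst AE_return) auto
      show "f \<in> borel_measurable (return borel a)" using that by simp
    qed
    have "(\<lambda>x. x) \<in> borel_measurable (borel :: real measure)"
      and "(\<lambda>x. (x - a)\<^sup>2) \<in> borel_measurable borel" by simp_all
    from this[THEN integrable] have "integrable N (\<lambda>x. x)" "integrable N (\<lambda>x. (x - a)\<^sup>2)"
      unfolding N .
    moreover have "(\<integral>x. x \<partial>N) = a" "(\<integral>x. (x - a)\<^sup>2 \<partial>N) = 0" "(\<integral>x. cis x \<partial>N) = cis a"
      unfolding N by (subst integral_return; simp)+
    ultimately show ?thesis by simp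
  next
    fix a \<sigma> :: real assume \<sigma>: "\<sigma> > 0" and N: "N = density lborel (\<lambda>t. ennreal (normal_density a \<sigma> t))"
    have mean: "(\<integral>x. x \<partial>N) = a"
      using integral_normal_moment_nz_1[OF \<sigma>, of a] by (simp add: N integral_density)
    have var: "(\<integral>x. (x - a)\<^sup>2 \<partial>N) = \<sigma>\<^sup>2"
      using integral_normal_moment_even[OF \<sigma>, of a 1] by (simp add: N integral_density)
    have "(\<integral>x. cis x \<partial>N) = (\<integral>x. normal_density a \<sigma> x *\<^sub>R cis x \<partial>lborel)"
      by (simp add: N integral_density)
    also have "\<dots> = \<bar>\<sigma>\<bar> *\<^sub>R (\<integral>x. normal_density a \<sigma> (a + \<sigma> * x) *\<^sub>R cis (a + \<sigma> * x) \<partial>lborel)"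
      using \<sigma> by (intro lborel_integral_real_affine) auto
    also have "\<dots> = (\<integral>x. cis a * (std_normal_density x *\<^sub>R cis (\<sigma> * x)) \<partial>lborel)"
    proof -
      have "\<sigma> * normal_density a \<sigma> (a + \<sigma> * x) = std_normal_density x" for x
        using \<sigma> by (simp add: normal_density_def real_sqrt_mult power_mult_distrib)
      then have eq: "\<bar>\<sigma>\<bar> *\<^sub>R normal_density a \<sigma> (a + \<sigma> * x) *\<^sub>R cis (a + \<sigma> * x)
          = cis a * (std_normal_density x *\<^sub>R cis (\<sigma> * x))" for x
        using \<sigma> by (simp flip: cis_mult)
      show ?thesis
        unfolding eq[symmetric] by (rule integral_scaleR_right[symmetric])
    qed
    also have "\<dots> = cis a * char std_normal_distribution \<sigma>"
    proof -
      have "char std_normal_distribution \<sigma> = (\<integral>x. std_normal_density x *\<^sub>R cis (\<sigma> * x) \<partial>lborel)"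
        by (simp add: char_eq_cis integral_density)
      then show ?thesis by (simp only: integral_mult_right_zero)
    qed
    also have "\<dots> = cis a * of_real (exp (- \<sigma>\<^sup>2 / 2))"
      by (simp add: char_std_normal_distribution)
    finally have "(\<integral>x. cis x \<partial>N) = \<dots>" .
    moreover have "integrable N (\<lambda>x. x)"
      using integrable_normal_moment_nz_1[OF \<sigma>, of a] by (simp add: N integrable_density)
    moreover have "integrable N (\<lambda>x. (x - a)\<^sup>2)"
      using integrable_normal_moment[OF \<sigma>, of a 2] by (simp add: N integrable_density)
    ultimately show ?thesis by (simp add: mean var)
  qed
  then show "integrable N (\<lambda>x. x)" "integrable N (\<lambda>x. (x - (\<integral>x. x \<partial>N))\<^sup>2)"
    "(\<integral>x. cis x \<partial>N) = cis (\<integral>x. x \<partial>N) * of_real (exp (- (\<integral>x. (x - (\<integral>x. x \<partial>N))\<^sup>2 \<partial>N) / 2))"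
    by auto
qed

lemma normal_law_translate:
  assumes "normal_law N"
  shows "normal_law (distr N borel (\<lambda>t. c + t))"
  using assms unfolding normal_law_def
proof (elim exE disjE conjE)
  fix a assume "N = return borel a"
  then have "distr N borel (\<lambda>t. c + t) = return borel (c + a)" by (simp add: distr_return)
  then show "\<exists>b. distr N borel (\<lambda>t. c + t) = return borel b \<or>
      (\<exists>\<sigma>>0. distr N borel (\<lambda>t. c + t) = density lborel (\<lambda>t. ennreal (normal_density b \<sigma> t)))"
    by blast
next
  fix a \<sigma> :: real assume \<sigma>: "\<sigma> > 0" and N: "N = density lborel (\<lambda>t. ennreal (normal_density a \<sigma> t))"
  interpret prob_space N unfolding N by (rule prob_space_normal_density[OF \<sigma>])
  have "distributed N lborel (\<lambda>t. t) (normal_density a \<sigma>)"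
    by (simp add: distributed_def N distr_id2)
  from normal_density_affine[OF this \<sigma>, of 1 c]
  have "distr N lborel (\<lambda>t. c + t) = density lborel (\<lambda>t. ennreal (normal_density (c + a) \<sigma> t))"
    by (simp add: distributed_def)
  moreover have "distr N lborel (\<lambda>t. c + t) = distr N borel (\<lambda>t. c + t)"
    by (rule distr_cong) auto
  ultimately show "\<exists>b. distr N borel (\<lambda>t. c + t) = return borel b \<or>
      (\<exists>\<sigma>>0. distr N borel (\<lambda>t. c + t) = density lborel (\<lambda>t. ennreal (normal_density b \<sigma> t)))"
    using \<sigma> by auto
qed

lemma mean_element_eqI:
  assumes "is_mean_element \<nu> z"
  shows "mean_element \<nu> = z"
  unfolding mean_element_def
proof (rule the_equality)
  show "is_mean_element \<nu> z" by (rule assms)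
  fix w assume "is_mean_element \<nu> w"
  then show "w = z" using assms by - (rule eq_if_functionals_eq, simp add: is_mean_element_def)
qed

locale gaussian =
  fixes \<mu> :: "'x::{banach,second_countable_topology} measure"
    and m :: 'x and C :: "('x \<Rightarrow>\<^sub>L real) \<Rightarrow> 'x"
  assumes gaussian_measure: "gaussian_measure \<mu>"
    and is_mean: "is_mean_element \<mu> m"
    and is_covariance: "is_covariance_operator \<mu> C"
begin

lemma sets_eq [measurable_cong, simp]: "sets \<mu> = sets borel"
  using gaussian_measure by (simp add: gaussian_measure_def)

lemma space_eq [simp]: "space \<mu> = UNIV"
  using sets_eq_imp_space_eq[OF sets_eq] by simp

sublocale prob_space \<mu>
  using gaussian_measure by (simp add: gaussian_measure_def)

lemma prob_UNIV [simp]: "measure \<mu> UNIV = 1"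
  using prob_space by simp

lemma normal_functional: "normal_law (distr \<mu> borel (blinfun_apply g))"
  using gaussian_measure by (simp add: gaussian_measure_iff)

lemma mean: "(\<integral>x. g x \<partial>\<mu>) = g m" for g :: "'x \<Rightarrow>\<^sub>L real"
  using is_mean by (simp add: is_mean_element_def)

lemma mean_element: "mean_element \<mu> = m"
  by (rule mean_element_eqI[OF is_mean])

lemma covariance: "k (C g) = (\<integral>x. (g x - g m) * (k x - k m) \<partial>\<mu>)" for k :: "'x \<Rightarrow>\<^sub>L real"
  using is_covariance by (simp add: is_covariance_operator_def mean_element)

lemma covariance_operator: "covariance_operator \<mu> = C"
  unfolding covariance_operator_def
proof (rule the_equality)
  show "is_covariance_operator \<mu> C" by (rule is_covariance)
  fix C' assume "is_covariance_operator \<mu> C'"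
  then show "C' = C"
    by - (rule ext, rule eq_if_functionals_eq, simp add: is_covariance_operator_def mean_element covariance)
qed

lemma C_sym: "k (C g) = g (C k)" for g k :: "'x \<Rightarrow>\<^sub>L real"
  by (simp add: covariance mult.commute)

text \<open>Symmetry moves the argument of \<open>C\<close> out of the integral, so linearity in it is linearity of the
pairing.\<close>

lemma linear_C: "linear C"
proof (rule linearI; rule eq_if_functionals_eq)
  fix g h k :: "'x \<Rightarrow>\<^sub>L real" and r
  show "k (C (g + h)) = k (C g + C h)"
    by (simp add: C_sym[of k] blinfun.add_left blinfun.add_right)
  show "k (C (r *\<^sub>R g)) = k (r *\<^sub>R C g)"
    by (simp add: C_sym[of k] blinfun.scaleR_left blinfun.scaleR_right)
qed

lemmas C_linear [simp] = linear_add[OF linear_C] linear_diff[OF linear_C] linear_scale[OF linear_C]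
  linear_0[OF linear_C]

lemma distr_mean: "(\<integral>x. x \<partial>distr \<mu> borel (blinfun_apply g)) = g m" for g :: "'x \<Rightarrow>\<^sub>L real"
  by (simp add: integral_distr mean)

lemma integrable_functional: "integrable \<mu> (blinfun_apply g)" for g :: "'x \<Rightarrow>\<^sub>L real"
  using normal_law_moments(1)[OF normal_functional, of g] by (simp add: integrable_distr_eq)

lemma integrable_centered_square: "integrable \<mu> (\<lambda>x. (g x - g m)\<^sup>2)" for g :: "'x \<Rightarrow>\<^sub>L real"
  using normal_law_moments(2)[OF normal_functional, of g] by (simp add: integrable_distr_eq distr_mean)

lemma variance: "(\<integral>x. (g x - g m)\<^sup>2 \<partial>\<mu>) = g (C g)" for g :: "'x \<Rightarrow>\<^sub>L real"
  by (simp add: covariance power2_eq_square)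

lemma variance_nonneg: "0 \<le> g (C g)" for g :: "'x \<Rightarrow>\<^sub>L real"
  unfolding variance[symmetric] by simp

lemma char_functional: "(\<integral>x. cis (g x) \<partial>\<mu>) = cis (g m) * of_real (exp (- g (C g) / 2))" for g :: "'x \<Rightarrow>\<^sub>L real"
proof -
  have "(\<integral>x. cis (g x) \<partial>\<mu>) = (\<integral>t. cis t \<partial>distr \<mu> borel (blinfun_apply g))"
    by (simp add: integral_distr)
  moreover have "(\<integral>t. (t - g m)\<^sup>2 \<partial>distr \<mu> borel (blinfun_apply g)) = g (C g)"
    by (simp add: integral_distr variance)
  ultimately show ?thesis
    using normal_law_moments(3)[OF normal_functional, of g] by (simp add: distr_mean)
qed

lemma AE_eq_mean_if_variance_zero:
  fixes g :: "'x \<Rightarrow>\<^sub>L real"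
  assumes "g (C g) = 0"
  shows "AE x in \<mu>. g x = g m"
proof -
  have "AE x in \<mu>. (g x - g m)\<^sup>2 = 0"
    using assms integral_nonneg_eq_0_iff_AE[OF integrable_centered_square[of g]] by (simp add: variance)
  then show ?thesis by eventually_elim simp
qed

lemma C_zero_if_variance_zero:
  fixes g :: "'x \<Rightarrow>\<^sub>L real"
  assumes "g (C g) = 0"
  shows "C g = 0"
proof (rule eq_if_functionals_eq)
  fix k :: "'x \<Rightarrow>\<^sub>L real"
  have "(\<integral>x. (g x - g m) * (k x - k m) \<partial>\<mu>) = (\<integral>x. 0 \<partial>\<mu>)"
    using AE_eq_mean_if_variance_zero[OF assms] by (intro integral_cong_AE) (auto elim: eventually_mono)
  then show "k (C g) = k 0" by (simp add: covariance blinfun.zero_right)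
qed

text \<open>If the image under \<open>A\<close> has covariance zero, it is concentrated at its mean: each functional of a
norming sequence is almost surely constant.\<close>

lemma AE_image_eq_mean_if_degenerate:
  fixes A :: "'x \<Rightarrow>\<^sub>L 'z::{banach,second_countable_topology}"
  assumes "\<And>h. conj_operator A C h = 0"
  shows "AE x in \<mu>. A x = A m"
proof -
  obtain f :: "nat \<Rightarrow> ('z \<Rightarrow>\<^sub>L real)" where f: "\<And>x r. norm x \<le> r \<longleftrightarrow> (\<forall>n. f n x \<le> r)"
    by (rule norming_sequence) auto
  have "AE x in \<mu>. (f n o\<^sub>L A) x = (f n o\<^sub>L A) m" for n
    using assms[of "f n"] by (intro AE_eq_mean_if_variance_zero) (simp add: conj_operator_def blinfun.zero_right)
  then have "AE x in \<mu>. \<forall>n. (f n o\<^sub>L A) x = (f n o\<^sub>L A) m"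
    by (simp add: AE_all_countable)
  then show ?thesis
  proof eventually_elim
    fix x assume "\<forall>n. (f n o\<^sub>L A) x = (f n o\<^sub>L A) m"
    then have "norm (A x - A m) \<le> 0" by (simp add: f blinfun.diff_right)
    then show "A x = A m" by simp
  qed
qed

lemma gaussian_affine:
  fixes A :: "'x \<Rightarrow>\<^sub>L 'z::{banach,second_countable_topology}"
  shows "gaussian (distr \<mu> borel (\<lambda>x. c + A x)) (c + A m) (conj_operator A C)"
proof
  let ?\<nu> = "distr \<mu> borel (\<lambda>x. c + A x)"
  have [measurable]: "(\<lambda>x. c + A x) \<in> borel_measurable \<mu>" by measurable
  have "normal_law (distr ?\<nu> borel (blinfun_apply h))" for h :: "'z \<Rightarrow>\<^sub>L real"
  proof -
    have "distr ?\<nu> borel (blinfun_apply h) = distr (distr \<mu> borel (blinfun_apply (h o\<^sub>L A))) borel (\<lambda>t. h c + t)"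
      by (subst (1 2) distr_distr) (auto simp: comp_def blinfun.add_right)
    then show ?thesis using normal_law_translate[OF normal_functional] by simp
  qed
  moreover have "prob_space ?\<nu>" by (rule prob_space_distr) measurable
  ultimately show "gaussian_measure ?\<nu>" by (simp add: gaussian_measure_iff)
  have mean_h: "(\<integral>z. h z \<partial>?\<nu>) = h (c + A m)" for h :: "'z \<Rightarrow>\<^sub>L real"
    using integrable_functional[of "h o\<^sub>L A"] mean[of "h o\<^sub>L A"]
    by (simp add: integral_distr blinfun.add_right Bochner_Integration.integral_add blinfun_compose.rep_eq comp_def)
  then show is_mean: "is_mean_element ?\<nu> (c + A m)" by (simp add: is_mean_element_def)
  have mean: "mean_element ?\<nu> = c + A m" by (rule mean_element_eqI[OF is_mean])
  show "is_covariance_operator ?\<nu> (conj_operator A C)"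
    unfolding is_covariance_operator_def mean
    using covariance[of "_ o\<^sub>L A" "_ o\<^sub>L A"]
    by (simp add: integral_distr blinfun.add_right conj_operator_def)
qed

end

text \<open>Mean and covariance determine the characteristic functional. In particular, the family of measures in
the definition of \<^const>\<open>conditional\<close> is determined by its Gaussian clause.\<close>

lemma gaussian_unique:
  assumes "gaussian \<mu> m C" "gaussian \<nu> m C"
  shows "\<mu> = \<nu>"
proof -
  interpret M: gaussian \<mu> m C by (rule assms)
  interpret N: gaussian \<nu> m C by (rule assms)
  show ?thesis
    by (rule measure_eq_if_char_functional_eq)
      (auto simp: M.char_functional N.char_functional M.finite_measure_axioms N.finite_measure_axioms)
qed

section \<open>Gains and posterior measures\<close>

text \<open>The condition on the Kalman gain \<open>L\<close>. It says that the residual \<open>x - L (G x)\<close> is uncorrelated with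
the observation \<open>G x\<close>. Stated in this way it fixes \<open>L\<close> on the range of \<open>G C G\<^sup>*\<close> and refers to no
representing sequence.\<close>

definition is_gain :: "(('x::real_normed_vector \<Rightarrow>\<^sub>L real) \<Rightarrow> 'x) \<Rightarrow> ('x \<Rightarrow>\<^sub>L 'y::real_normed_vector) \<Rightarrow>
    ('y \<Rightarrow>\<^sub>L 'x) \<Rightarrow> bool" where
  "is_gain C G L \<longleftrightarrow> (\<forall>h. L (conj_operator G C h) = C (h o\<^sub>L G))"

text \<open>The residual \<open>x - L (G x)\<close> shifted by \<open>L y\<close>: if \<open>L\<close> is a gain, the residual is independent of
the observation, and only the term \<open>L (G x)\<close> is affected by the condition \<open>G x = y\<close>.\<close>

definition posterior :: "'x::real_normed_vector measure \<Rightarrow> ('x \<Rightarrow>\<^sub>L 'y::real_normed_vector) \<Rightarrow>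
    ('y \<Rightarrow>\<^sub>L 'x) \<Rightarrow> 'y \<Rightarrow> 'x measure" where
  "posterior \<mu> G L y = distr \<mu> borel (\<lambda>x. x + L (y - G x))"

context gaussian
begin

lemma gainD: "is_gain C G L \<Longrightarrow> L (G (C (h o\<^sub>L G))) = C (h o\<^sub>L G)"
  by (simp add: is_gain_def conj_operator_def)

lemma gaussian_posterior:
  fixes G :: "'x \<Rightarrow>\<^sub>L 'y::{banach,second_countable_topology}"
  assumes L: "is_gain C G L"
  shows "gaussian (posterior \<mu> G L y) (m + L (y - G m)) (\<lambda>g. C g - L (G (C g)))"
proof -
  define A where "A = id_blinfun - (L o\<^sub>L G)"
  have A: "A x = x - L (G x)" for x by (simp add: A_def blinfun.diff_left)
  have "posterior \<mu> G L y = distr \<mu> borel (\<lambda>x. L y + A x)"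
    by (simp add: posterior_def A blinfun.diff_right algebra_simps)
  moreover have "conj_operator A C = (\<lambda>g. C g - L (G (C g)))"
  proof
    fix g :: "'x \<Rightarrow>\<^sub>L real"
    have "g o\<^sub>L A = g - ((g o\<^sub>L L) o\<^sub>L G)"
      by (rule blinfun_eqI) (simp add: A blinfun.diff_left blinfun.diff_right)
    then show "conj_operator A C g = C g - L (G (C g))"
      by (simp add: conj_operator_def A gainD[OF L] blinfun.diff_right)
  qed
  moreover have "m + L (y - G m) = L y + A m"
    by (simp add: A blinfun.diff_right)
  ultimately show ?thesis using gaussian_affine[of "L y" A] by simp
qed

text \<open>The operators of two gains agree on the range of \<open>G C G\<^sup>*\<close>, so their difference maps the observation
to a variable of covariance zero.\<close>

lemma AE_gain_eq:
  fixes G :: "'x \<Rightarrow>\<^sub>L 'y::{banach,second_countable_topology}"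
  assumes L: "is_gain C G L" and L': "is_gain C G L'"
  shows "AE x in \<mu>. L (G x - G m) = L' (G x - G m)"
proof -
  have "AE x in \<mu>. ((L - L') o\<^sub>L G) x = ((L - L') o\<^sub>L G) m"
  proof (rule AE_image_eq_mean_if_degenerate)
    fix h :: "_ \<Rightarrow>\<^sub>L real"
    have "h o\<^sub>L ((L - L') o\<^sub>L G) = (h o\<^sub>L (L - L')) o\<^sub>L G" by (rule blinfun_eqI) simp
    then show "conj_operator ((L - L') o\<^sub>L G) C h = 0"
      by (simp add: conj_operator_def blinfun.diff_left gainD[OF L] gainD[OF L'])
  qed
  then show ?thesis by eventually_elim (simp add: blinfun.diff_left blinfun.diff_right algebra_simps)
qed

text \<open>The choice of the gain, hence that of a representing sequence, affects the conditional measures only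
for a null set of observations.\<close>

lemma AE_posterior_eq:
  fixes G :: "'x \<Rightarrow>\<^sub>L 'y::{banach,second_countable_topology}"
  assumes L: "is_gain C G L" and L': "is_gain C G L'"
  shows "AE y in distr \<mu> borel G. posterior \<mu> G L y = posterior \<mu> G L' y"
proof -
  have AE_x: "AE x in \<mu>. L (G x - G m) = L' (G x - G m)" by (rule AE_gain_eq[OF L L'])
  have "closed {y. L (y - G m) = L' (y - G m)}"
    by (intro closed_Collect_eq continuous_intros)
  then have "AE y in distr \<mu> borel G. L (y - G m) = L' (y - G m)"
    using AE_x by (subst AE_distr_iff) (auto intro: borel_closed)
  then show ?thesis
  proof eventually_elim
    fix y assume y: "L (y - G m) = L' (y - G m)"
    have "AE x in \<mu>. x + L (y - G x) = x + L' (y - G x)"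
      using AE_x
    proof eventually_elim
      fix x assume x: "L (G x - G m) = L' (G x - G m)"
      have "y - G x = (y - G m) - (G x - G m)" by simp
      then show "x + L (y - G x) = x + L' (y - G x)"
        by (simp only: blinfun.diff_right[of _ "y - G m" "G x - G m"] x y)
    qed
    then show "posterior \<mu> G L y = posterior \<mu> G L' y"
      unfolding posterior_def by (intro distr_cong_AE) auto
  qed
qed

text \<open>The observation of the residual has covariance zero. Therefore \<open>L y\<close> determines \<open>y\<close> for almost every
observation \<open>y\<close>, which is why the conditional measures are concentrated on the fibres of \<open>G\<close>.\<close>

lemma gain_reconstructs:
  fixes G :: "'x \<Rightarrow>\<^sub>L 'y::{banach,second_countable_topology}"
  assumes L: "is_gain C G L"
  shows "AE x in \<mu>. G (L (G x - G m)) = G x - G m"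
proof -
  let ?A = "G - (G o\<^sub>L L o\<^sub>L G)"
  have "AE x in \<mu>. ?A x = ?A m"
  proof (rule AE_image_eq_mean_if_degenerate)
    fix h :: "_ \<Rightarrow>\<^sub>L real"
    have "h o\<^sub>L ?A = (h - (h o\<^sub>L G o\<^sub>L L)) o\<^sub>L G"
      by (rule blinfun_eqI) (simp add: blinfun.diff_left blinfun.diff_right)
    then show "conj_operator ?A C h = 0"
      by (simp add: conj_operator_def blinfun.diff_left gainD[OF L])
  qed
  then show ?thesis by eventually_elim (simp add: blinfun.diff_left blinfun.diff_right algebra_simps)
qed

lemma borel_pair: "sets (\<mu> \<Otimes>\<^sub>M \<mu>) = sets (borel :: ('x \<times> 'x) measure)"
  by (simp add: borel_prod[symmetric] cong: sets_pair_measure_cong)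

lemma mixture_measurable:
  fixes G :: "'x \<Rightarrow>\<^sub>L 'y::{banach,second_countable_topology}" and L :: "'y \<Rightarrow>\<^sub>L 'x"
  shows "(\<lambda>(x, x'). x' + L (G x - G x')) \<in> borel_measurable (\<mu> \<Otimes>\<^sub>M \<mu>)"
  unfolding measurable_cong_sets[OF borel_pair refl] case_prod_beta
  by (intro borel_measurable_continuous_onI continuous_intros)

text \<open>This is the independence of observation and residual: replacing the residual of \<open>x\<close> by that of an
independent copy \<open>x'\<close> does not change the law. Both sides are compared by characteristic functionals.
With \<open>k = g \<circ> L \<circ> G\<close> the integral factors into those of \<open>k\<close> and \<open>g - k\<close>, and the variances of
these add up to that of \<open>g\<close> since the gain condition makes them uncorrelated.\<close>

lemma posterior_mixture:
  fixes G :: "'x \<Rightarrow>\<^sub>L 'y::{banach,second_countable_topology}"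
  assumes L: "is_gain C G L"
  shows "distr (\<mu> \<Otimes>\<^sub>M \<mu>) borel (\<lambda>(x, x'). x' + L (G x - G x')) = \<mu>"
proof -
  interpret P: pair_prob_space \<mu> \<mu> ..
  let ?W = "\<lambda>(x, x'). x' + L (G x - G x')"
  have W: "?W \<in> borel_measurable (\<mu> \<Otimes>\<^sub>M \<mu>)" by (rule mixture_measurable)
  show ?thesis
  proof (rule measure_eq_if_char_functional_eq)
    show "finite_measure (distr (\<mu> \<Otimes>\<^sub>M \<mu>) borel ?W)" by (rule P.finite_measure_distr[OF W])
    fix g :: "'x \<Rightarrow>\<^sub>L real"
    define k where "k = (g o\<^sub>L L) o\<^sub>L G"
    have "g (?W z) = k (fst z) + (g - k) (snd z)" for z
      by (simp add: k_def case_prod_beta blinfun.diff_left blinfun.diff_right blinfun.add_right)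
    then have "(\<integral>x. cis (g x) \<partial>distr (\<mu> \<Otimes>\<^sub>M \<mu>) borel ?W)
        = (\<integral>z. cis (k (fst z)) * cis ((g - k) (snd z)) \<partial>(\<mu> \<Otimes>\<^sub>M \<mu>))"
      by (subst integral_distr[OF W]) (simp_all add: cis_mult)
    also have "\<dots> = (\<integral>x. \<integral>x'. cis (k x) * cis ((g - k) x') \<partial>\<mu> \<partial>\<mu>)"
    proof (subst P.integral_fst'[symmetric])
      show "integrable (\<mu> \<Otimes>\<^sub>M \<mu>) (\<lambda>z. cis (k (fst z)) * cis ((g - k) (snd z)))"
        by (rule P.integrable_const_bound[of _ 1]) (auto simp: norm_mult)
    qed simp
    also have "\<dots> = (\<integral>x. cis (k x) \<partial>\<mu>) * (\<integral>x'. cis ((g - k) x') \<partial>\<mu>)" by simp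
    also have "\<dots> = cis (k m + (g - k) m) * of_real (exp (- (k (C k) + (g - k) (C (g - k))) / 2))"
      by (simp add: char_functional cis_mult[symmetric] exp_add[symmetric] add_divide_distrib flip: of_real_mult)
    also have "k (C k) + (g - k) (C (g - k)) = g (C g)"
    proof -
      have "k (C k) = g (C k)" by (simp add: k_def gainD[OF L])
      then show ?thesis using C_sym[of k g] by (simp add: blinfun.diff_left blinfun.diff_right)
    qed
    also have "k m + (g - k) m = g m" by (simp add: blinfun.diff_left)
    finally show "(\<integral>x. cis (g x) \<partial>distr (\<mu> \<Otimes>\<^sub>M \<mu>) borel ?W) = (\<integral>x. cis (g x) \<partial>\<mu>)"
      by (simp add: char_functional)
  qed (auto simp: finite_measure_axioms)
qed

end

context gaussian
begin

lemma update_measurable: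
  fixes G :: "'x \<Rightarrow>\<^sub>L 'y::{banach,second_countable_topology}" and L :: "'y \<Rightarrow>\<^sub>L 'x"
  shows "(\<lambda>x. x + L (y - G x)) \<in> borel_measurable \<mu>"
  unfolding measurable_cong_sets[OF sets_eq refl]
  by (intro borel_measurable_continuous_onI continuous_intros)

lemma measure_posterior:
  fixes G :: "'x \<Rightarrow>\<^sub>L 'y::{banach,second_countable_topology}"
  assumes A: "A \<in> sets borel"
  shows "measure (posterior \<mu> G L y) A = (\<integral>x. indicator A (x + L (y - G x)) \<partial>\<mu>)"
proof -
  have "measure (posterior \<mu> G L y) A = (\<integral>x. indicator A x \<partial>posterior \<mu> G L y)"
    by (simp add: posterior_def A)
  also have "\<dots> = (\<integral>x. indicator A (x + L (y - G x)) \<partial>\<mu>)"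
    unfolding posterior_def using A by (intro integral_distr update_measurable) simp
  finally show ?thesis .
qed

lemma measurable_posterior:
  fixes G :: "'x \<Rightarrow>\<^sub>L 'y::{banach,second_countable_topology}"
  assumes A: "A \<in> sets borel"
  shows "(\<lambda>y. measure (posterior \<mu> G L y) A) \<in> borel_measurable borel"
proof -
  have "(\<lambda>(y, x). x + L (y - G x)) \<in> borel_measurable (borel :: ('y \<times> 'x) measure)"
    unfolding case_prod_beta by (intro borel_measurable_continuous_onI continuous_intros)
  moreover have "sets (borel \<Otimes>\<^sub>M \<mu>) = sets (borel :: ('y \<times> 'x) measure)"
    by (simp add: borel_prod[symmetric] cong: sets_pair_measure_cong)
  ultimately have "(\<lambda>(y, x). x + L (y - G x)) \<in> borel_measurable (borel \<Otimes>\<^sub>M \<mu>)"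
    by (simp cong: measurable_cong_sets)
  moreover have "(indicator A :: 'x \<Rightarrow> real) \<in> borel_measurable borel" using A by simp
  ultimately have "(\<lambda>z. indicator A (case z of (y, x) \<Rightarrow> x + L (y - G x)) :: real)
      \<in> borel_measurable (borel \<Otimes>\<^sub>M \<mu>)"
    by (rule measurable_compose)
  then have "(\<lambda>(y, x). indicator A (x + L (y - G x)) :: real) \<in> borel_measurable (borel \<Otimes>\<^sub>M \<mu>)"
    by (simp add: case_prod_beta)
  then show "(\<lambda>y. measure (posterior \<mu> G L y) A) \<in> borel_measurable borel"
    unfolding measure_posterior[OF A] by (rule borel_measurable_lebesgue_integral)
qed

text \<open>The fibre condition holds on the closed affine set of those \<open>y\<close> that \<open>L y\<close> reconstructs; the mixture
formula is \<open>posterior_mixture\<close> integrated over the copy \<open>x'\<close> first.\<close>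

lemma disintegration_posterior:
  fixes G :: "'x \<Rightarrow>\<^sub>L 'y::{banach,second_countable_topology}"
  assumes L: "is_gain C G L"
  shows "disintegration \<mu> borel (blinfun_apply G) (posterior \<mu> G L)"
  unfolding disintegration_def
proof (intro conjI ballI)
  fix y
  interpret post: gaussian "posterior \<mu> G L y" "m + L (y - G m)" "\<lambda>g. C g - L (G (C g))"
    by (rule gaussian_posterior[OF L])
  show "sets (posterior \<mu> G L y) = sets \<mu>" by simp
  show "prob_space (posterior \<mu> G L y)" by (rule post.prob_space_axioms)
next
  fix A assume "A \<in> sets \<mu>"
  then have A: "A \<in> sets borel" by simp
  show "(\<lambda>y. measure (posterior \<mu> G L y) A) \<in> borel_measurable borel"
    by (rule measurable_posterior[OF A])
next
  define S where "S = {y. G (L (y - G m)) = y - G m}"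
  have S: "S \<in> sets borel"
    unfolding S_def by (intro borel_closed closed_Collect_eq continuous_intros)
  have AE_S: "AE x in \<mu>. G x \<in> S"
    using gain_reconstructs[OF L] by (simp add: S_def)
  show "\<exists>S\<in>sets borel. measure (distr \<mu> borel G) S = 1 \<and>
      (\<forall>y\<in>S. {y} \<in> sets borel \<and> measure (posterior \<mu> G L y) (G -` {y} \<inter> space \<mu>) = 1)"
  proof (intro bexI[OF _ S] conjI ballI)
    have "measure (distr \<mu> borel G) S = measure \<mu> (G -` S)"
      using S by (subst measure_distr) auto
    also have "\<dots> = 1"
      using AE_S measurable_sets_borel[OF borel_measurable_blinfun_apply S] by (subst prob_eq_1) auto
    finally show "measure (distr \<mu> borel G) S = 1" .
    fix y assume y: "y \<in> S"
    show "{y} \<in> sets borel" by simp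
    have Gy: "G -` {y} \<in> sets borel"
      by (rule measurable_sets_borel[OF borel_measurable_blinfun_apply]) simp
    have "AE x in \<mu>. indicator (G -` {y}) (x + L (y - G x)) = (1 :: real)"
      using AE_S
    proof eventually_elim
      fix x assume x: "G x \<in> S"
      have "y - G x = (y - G m) - (G x - G m)" by simp
      then have "G (L (y - G x)) = G (L (y - G m)) - G (L (G x - G m))"
        by (simp only: blinfun.diff_right[of _ "y - G m" "G x - G m"] blinfun.diff_right[of G "L (y - G m)"])
      then have "G (x + L (y - G x)) = y"
        using x y by (simp add: S_def blinfun.add_right)
      then show "indicator (G -` {y}) (x + L (y - G x)) = (1 :: real)" by simp
    qed
    then have "(\<integral>x. indicator (G -` {y}) (x + L (y - G x)) \<partial>\<mu>) = (\<integral>x. (1 :: real) \<partial>\<mu>)"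
      by (intro integral_cong_AE measurable_compose[OF update_measurable] borel_measurable_indicator Gy) auto
    then show "measure (posterior \<mu> G L y) (G -` {y} \<inter> space \<mu>) = 1"
      by (simp add: measure_posterior[OF Gy])
  qed
next
  fix A assume "A \<in> sets \<mu>"
  then have A: "A \<in> sets borel" by simp
  interpret P: pair_prob_space \<mu> \<mu> ..
  let ?W = "\<lambda>(x, x'). x' + L (G x - G x')"
  have W: "?W \<in> borel_measurable (\<mu> \<Otimes>\<^sub>M \<mu>)" by (rule mixture_measurable)
  have indicator: "(indicator A :: 'x \<Rightarrow> real) \<in> borel_measurable borel" using A by simp
  have integrable: "integrable (\<mu> \<Otimes>\<^sub>M \<mu>) (\<lambda>z. indicator A (?W z) :: real)"
    by (rule P.integrable_const_bound[of _ 1]) (auto intro: measurable_compose[OF W indicator])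
  have "measure \<mu> A = (\<integral>x. indicator A x \<partial>distr (\<mu> \<Otimes>\<^sub>M \<mu>) borel ?W)"
    by (simp add: posterior_mixture[OF L] A)
  also have "\<dots> = (\<integral>z. indicator A (?W z) \<partial>(\<mu> \<Otimes>\<^sub>M \<mu>))"
    by (rule integral_distr[OF W indicator])
  also have "\<dots> = (\<integral>x. \<integral>x'. indicator A (x' + L (G x - G x')) \<partial>\<mu> \<partial>\<mu>)"
    using P.integral_fst'[OF integrable] by simp
  also have "\<dots> = (\<integral>x. measure (posterior \<mu> G L (G x)) A \<partial>\<mu>)"
    by (simp add: measure_posterior[OF A])
  also have "\<dots> = (\<integral>y. measure (posterior \<mu> G L y) A \<partial>distr \<mu> borel G)"
    by (subst integral_distr[OF _ measurable_posterior[OF A]]) auto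
  finally show "measure \<mu> A = \<dots>" .
qed

end

section \<open>Representing sequences\<close>

text \<open>The first half of \<^const>\<open>representing\<close>: orthonormality for the semi-inner product \<open>\<langle>R g, h\<rangle>\<close> on the dual.\<close>

definition orthonormal :: "(('y::real_normed_vector \<Rightarrow>\<^sub>L real) \<Rightarrow> 'y) \<Rightarrow> nat \<Rightarrow> (nat \<Rightarrow> ('y \<Rightarrow>\<^sub>L real)) \<Rightarrow> bool" where
  "orthonormal R n ys \<longleftrightarrow> (\<forall>i<n. \<forall>j<n. ys j (R (ys i)) = (if i = j then 1 else 0))"

text \<open>One step of the Gram-Schmidt process for \<open>\<langle>R g, h\<rangle>\<close>, before normalisation.\<close>

definition residual :: "(('y::real_normed_vector \<Rightarrow>\<^sub>L real) \<Rightarrow> 'y) \<Rightarrow> nat \<Rightarrow> (nat \<Rightarrow> ('y \<Rightarrow>\<^sub>L real)) \<Rightarrow>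
    ('y \<Rightarrow>\<^sub>L real) \<Rightarrow> ('y \<Rightarrow>\<^sub>L real)" where
  "residual R n ys g = g - (\<Sum>i<n. ys i (R g) *\<^sub>R ys i)"

context gaussian
begin

text \<open>The second equation is Bessel's inequality together with its defect: the Parseval identity for \<open>g\<close> holds
exactly if the residual has variance zero.\<close>

lemma orthonormal_residual:
  assumes ys: "orthonormal C n ys"
  shows "j < n \<Longrightarrow> ys j (C (residual C n ys g)) = 0"
    and "residual C n ys g (C (residual C n ys g)) = g (C g) - (\<Sum>i<n. (g (C (ys i)))\<^sup>2)"
proof -
  let ?r = "residual C n ys"
  have orth: "ys j (C (?r g)) = 0" if j: "j < n" for j
  proof -
    have "(\<Sum>i<n. ys i (C g) * ys j (C (ys i))) = (\<Sum>i<n. if i = j then ys i (C g) else 0)"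
      using ys j by (intro sum.cong) (auto simp: orthonormal_def)
    then show ?thesis
      using j by (simp add: residual_def linear_sum[OF linear_C] blinfun.diff_right blinfun.sum_right blinfun.scaleR_right)
  qed
  then show "j < n \<Longrightarrow> ys j (C (?r g)) = 0" .
  have "?r g (C (?r g)) = g (C (?r g)) - (\<Sum>i<n. ys i (C g) * ys i (C (?r g)))"
    by (subst (1) residual_def, simp add: blinfun.diff_left blinfun.sum_left blinfun.scaleR_left)
  also have "\<dots> = g (C (?r g))" using orth by simp
  also have "\<dots> = g (C g) - (\<Sum>i<n. ys i (C g) * g (C (ys i)))"
    by (simp add: residual_def linear_sum[OF linear_C] blinfun.diff_right blinfun.sum_right blinfun.scaleR_right)
  also have "(\<Sum>i<n. ys i (C g) * g (C (ys i))) = (\<Sum>i<n. (g (C (ys i)))\<^sup>2)"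
    by (intro sum.cong) (simp_all add: C_sym[of g] power2_eq_square)
  finally show "?r g (C (?r g)) = g (C g) - (\<Sum>i<n. (g (C (ys i)))\<^sup>2)" .
qed

lemma orthonormal_card_le:
  assumes ys: "orthonormal C n ys" and B: "finite B" "range C \<subseteq> span B"
  shows "n \<le> card B"
proof -
  have one: "ys i (C (ys i)) = 1" and zero: "i \<noteq> j \<Longrightarrow> ys i (C (ys j)) = 0" if "i < n" "j < n" for i j
    using ys that by (auto simp: orthonormal_def)
  have inj: "inj_on (\<lambda>i. C (ys i)) {..<n}"
    by (rule inj_onI) (metis lessThan_iff one zero zero_neq_one)
  have "independent ((\<lambda>i. C (ys i)) ` {..<n})"
    unfolding dependent_def
  proof safe
    fix i assume i: "i < n" and in_span: "C (ys i) \<in> span ((\<lambda>i. C (ys i)) ` {..<n} - {C (ys i)})"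
    have "ys i x = 0" if x: "x \<in> (\<lambda>i. C (ys i)) ` {..<n} - {C (ys i)}" for x
    proof -
      obtain j where "j < n" "x = C (ys j)" "i \<noteq> j" using x by blast
      then show ?thesis using zero[OF i] by simp
    qed
    then have "ys i (C (ys i)) = 0"
      by (rule linear_eq_0_on_span[OF bounded_linear.linear[OF blinfun.bounded_linear_right] _ in_span])
    then show False using one[OF i] i by simp
  qed
  then have "card ((\<lambda>i. C (ys i)) ` {..<n}) \<le> card B"
    using B independent_span_bound[of B "(\<lambda>i. C (ys i)) ` {..<n}"] by auto
  then show ?thesis by (simp add: card_image[OF inj])
qed

text \<open>An orthonormal family has linearly independent images under \<open>C\<close>, so its length is at most the rank. A
family of maximal length represents \<open>C\<close>, since a residual of positive variance could be normalised and
appended; and its images then span the range of \<open>C\<close>, which shows that the length is the rank.\<close>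

lemma exists_representing:
  assumes "has_finite_rank C p"
  shows "\<exists>ys. representing C {..<p} ys"
proof -
  obtain B0 where B0: "finite B0" "range C \<subseteq> span B0" and p: "dim (range C) = p"
    using assms by (auto simp: has_finite_rank_def)
  obtain B where B: "B \<subseteq> range C" "independent B" "range C \<subseteq> span B" "card B = dim (range C)"
    by (rule basis_exists)
  have "finite B" using independent_span_bound[OF B0(1) B(2)] B(1) B0(2) by blast
  then have bound: "n \<le> p" if "orthonormal C n ys" for n ys
    using orthonormal_card_le[OF that _ B(3)] B(4) p by simp
  have "\<exists>ys. orthonormal C 0 ys" by (simp add: orthonormal_def)
  then obtain n where "\<exists>ys. orthonormal C n ys" and max: "\<And>k. (\<exists>ys. orthonormal C k ys) \<Longrightarrow> k \<le> n"
    using Nat.ex_has_greatest_nat[of "\<lambda>n. \<exists>ys. orthonormal C n ys" 0 "p"] bound by blast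
  then obtain ys where ys: "orthonormal C n ys" by blast
  define r where "r = residual C n ys"
  note residual = orthonormal_residual[OF ys, folded r_def]
  have r0: "r g (C (r g)) = 0" for g
  proof (rule ccontr)
    assume "r g (C (r g)) \<noteq> 0"
    then have pos: "0 < r g (C (r g))" using variance_nonneg[of "r g"] by simp
    define e where "e = (1 / sqrt (r g (C (r g)))) *\<^sub>R r g"
    have "e (C e) = 1"
      using pos by (simp add: e_def blinfun.scaleR_left blinfun.scaleR_right)
    moreover have "ys j (C e) = 0" "e (C (ys j)) = 0" if "j < n" for j
      using residual(1)[OF that] C_sym[of e "ys j"]
      by (simp_all add: e_def blinfun.scaleR_right)
    ultimately have "orthonormal C (Suc n) (ys(n := e))"
      using ys by (auto simp: orthonormal_def less_Suc_eq)
    then show False using max by (metis not_less_eq_eq order_refl)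
  qed
  have C_sum: "C g = (\<Sum>i<n. ys i (C g) *\<^sub>R C (ys i))" for g
    using C_zero_if_variance_zero[OF r0[of g]] by (simp add: r_def residual_def linear_sum[OF linear_C])
  have "range C \<subseteq> span ((\<lambda>i. C (ys i)) ` {..<n})"
  proof
    fix z assume "z \<in> range C"
    then obtain g where "z = C g" by blast
    then show "z \<in> span ((\<lambda>i. C (ys i)) ` {..<n})"
      by (subst \<open>z = C g\<close>, subst C_sum) (intro span_sum span_scale span_base imageI)
  qed
  then have "p \<le> card ((\<lambda>i. C (ys i)) ` {..<n})" unfolding p[symmetric] by (rule dim_le_card) simp
  also have "\<dots> \<le> n" using card_image_le[of "{..<n}" "\<lambda>i. C (ys i)"] by simp
  finally have "n = p" using bound[OF ys] by simp
  have "((\<lambda>i. (g (C (ys i)))\<^sup>2) has_sum g (C g)) {..<n}" for g :: "'x \<Rightarrow>\<^sub>L real"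
    using r0[of g] residual(2)[of g] by (intro has_sum_finiteI) auto
  then show ?thesis
    using ys unfolding \<open>n = p\<close> by (intro exI[of _ ys]) (simp add: representing_def orthonormal_def)
qed

lemma representing_expansion:
  fixes p :: nat
  assumes "representing C {..<p} ys"
  shows "C g = (\<Sum>i<p. ys i (C g) *\<^sub>R C (ys i))"
proof -
  define r where "r = residual C p ys g"
  have ys: "orthonormal C p ys" using assms by (auto simp: representing_def orthonormal_def)
  have "((\<lambda>i. (g (C (ys i)))\<^sup>2) has_sum g (C g)) {..<p}"
    using assms by (simp add: representing_def)
  then have "(\<Sum>i<p. (g (C (ys i)))\<^sup>2) = g (C g)"
    by (rule has_sum_unique[rotated]) simp
  then have "r (C r) = 0" using orthonormal_residual(2)[OF ys, of g] by (simp add: r_def)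
  from C_zero_if_variance_zero[OF this] show ?thesis
    by (simp add: r_def residual_def linear_sum[OF linear_C])
qed

lemma gaussian_image:
  fixes G :: "'x \<Rightarrow>\<^sub>L 'y::{banach,second_countable_topology}"
  shows "gaussian (distr \<mu> borel (blinfun_apply G)) (G m) (conj_operator G C)"
  using gaussian_affine[of 0 G] by simp

end

text \<open>The linear operator by which an observation corrects the mean in the definition of
\<^const>\<open>conditional\<close>.\<close>

definition regression_gain :: "(('x::real_normed_vector \<Rightarrow>\<^sub>L real) \<Rightarrow> 'x) \<Rightarrow> ('x \<Rightarrow>\<^sub>L 'y::real_normed_vector) \<Rightarrow>
    nat \<Rightarrow> (nat \<Rightarrow> ('y \<Rightarrow>\<^sub>L real)) \<Rightarrow> 'y \<Rightarrow>\<^sub>L 'x" where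
  "regression_gain C G p ys = (\<Sum>i<p. blinfun_scaleR_left (C (ys i o\<^sub>L G)) o\<^sub>L ys i)"

lemma regression_gain_apply:
  "regression_gain C G p ys y = (\<Sum>i<p. ys i y *\<^sub>R C (ys i o\<^sub>L G))"
  by (simp add: regression_gain_def blinfun.sum_left)

context gaussian
begin

text \<open>By the Parseval identity the residual of \<open>h\<close> has variance zero for the image measure, that is, its
composition with \<open>G\<close> has variance zero for \<open>\<mu>\<close> and is annihilated by \<open>C\<close>.\<close>

lemma is_gain_regression_gain:
  fixes G :: "'x \<Rightarrow>\<^sub>L 'y::{banach,second_countable_topology}"
  assumes ys: "representing (conj_operator G C) {..<p} ys"
  shows "is_gain C G (regression_gain C G p ys)"
  unfolding is_gain_def
proof
  fix h :: "'y \<Rightarrow>\<^sub>L real"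
  interpret image: gaussian "distr \<mu> borel (blinfun_apply G)" "G m" "conj_operator G C"
    by (rule gaussian_image)
  define r where "r = h - (\<Sum>i<p. ys i (conj_operator G C h) *\<^sub>R ys i)"
  have "conj_operator G C r = 0"
    using image.representing_expansion[OF ys, of h] by (simp add: r_def linear_sum[OF image.linear_C])
  then have "(r o\<^sub>L G) (C (r o\<^sub>L G)) = 0" by (simp add: conj_operator_def)
  then have "C (r o\<^sub>L G) = 0" by (rule C_zero_if_variance_zero)
  moreover have "r o\<^sub>L G = (h o\<^sub>L G) - (\<Sum>i<p. ys i (conj_operator G C h) *\<^sub>R (ys i o\<^sub>L G))"
    by (rule blinfun_eqI) (simp add: r_def blinfun.diff_left blinfun.sum_left blinfun.scaleR_left)
  ultimately show "regression_gain C G p ys (conj_operator G C h) = C (h o\<^sub>L G)"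
    by (simp add: regression_gain_apply linear_sum[OF linear_C])
qed

lemma exists_representing_sequence:
  fixes G :: "'x \<Rightarrow>\<^sub>L 'y::{banach,second_countable_topology}"
  assumes "has_finite_rank (conj_operator G C) p"
  shows "\<exists>ys. representing_sequence \<mu> G p ys"
  using assms gaussian.exists_representing[OF gaussian_image[of G] assms]
  by (simp add: representing_sequence_def covariance_operator)

lemma representing_sequence_gain:
  fixes G :: "'x \<Rightarrow>\<^sub>L 'y::{banach,second_countable_topology}"
  assumes "representing_sequence \<mu> G p ys"
  shows "is_gain C G (regression_gain C G p ys)"
  using assms by (intro is_gain_regression_gain) (simp add: representing_sequence_def covariance_operator)

text \<open>The posterior measures satisfy the description that defines \<^const>\<open>conditional\<close>, and a family that
satisfies it has the same means and covariances, hence equals them for every \<open>y\<close>.\<close>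

lemma conditional_eq_posterior:
  fixes G :: "'x \<Rightarrow>\<^sub>L 'y::{banach,second_countable_topology}"
  assumes ys: "representing_sequence \<mu> G p ys"
  shows "conditional \<mu> G p ys = posterior \<mu> G (regression_gain C G p ys)"
proof -
  let ?L = "regression_gain C G p ys"
  let ?mean = "\<lambda>y. m + (\<Sum>i<p. ys i (y - G m) *\<^sub>R C (ys i o\<^sub>L G))"
  let ?cov = "\<lambda>g. C g - (\<Sum>i<p. g (C (ys i o\<^sub>L G)) *\<^sub>R C (ys i o\<^sub>L G))"
  have L: "is_gain C G ?L" by (rule representing_sequence_gain[OF ys])
  have "?cov = (\<lambda>g. C g - ?L (G (C g)))"
  proof
    fix g :: "'x \<Rightarrow>\<^sub>L real"
    show "?cov g = C g - ?L (G (C g))" by (simp add: regression_gain_apply C_sym[of g])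
  qed
  then have post: "gaussian (posterior \<mu> G ?L y) (?mean y) ?cov" for y
    using gaussian_posterior[OF L, of y] by (simp add: regression_gain_apply)
  show ?thesis
    unfolding conditional_def mean_element covariance_operator Let_def
  proof (rule the_equality)
    show "disintegration \<mu> borel (blinfun_apply G) (posterior \<mu> G ?L) \<and>
        (\<forall>y. gaussian_measure (posterior \<mu> G ?L y) \<and> is_mean_element (posterior \<mu> G ?L y) (?mean y) \<and>
          is_covariance_operator (posterior \<mu> G ?L y) ?cov)"
      using post disintegration_posterior[OF L] unfolding gaussian_def by blast
  next
    fix K
    assume "disintegration \<mu> borel (blinfun_apply G) K \<and>
        (\<forall>y. gaussian_measure (K y) \<and> is_mean_element (K y) (?mean y) \<and> is_covariance_operator (K y) ?cov)"
    then have "gaussian (K y) (?mean y) ?cov" for y unfolding gaussian_def by blast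
    then show "K = posterior \<mu> G ?L" using gaussian_unique post by (intro ext) blast
  qed
qed

text \<open>Finite rank passes from \<open>G C G\<^sup>*\<close> to \<open>C G\<^sup>*\<close>, because a gain recovers the latter from the former.
Ranges of this kind can be added up, which yields finite rank for the pair of operators.\<close>

lemma finite_rank_span:
  fixes G :: "'x \<Rightarrow>\<^sub>L 'y::{banach,second_countable_topology}"
  assumes "has_finite_rank (conj_operator G C) p"
  obtains S where "finite S" "\<And>h. C (h o\<^sub>L G) \<in> span S"
proof -
  obtain ys where ys: "representing_sequence \<mu> G p ys" using exists_representing_sequence[OF assms] ..
  let ?S = "(\<lambda>i. C (ys i o\<^sub>L G)) ` {..<p}"
  have "C (h o\<^sub>L G) \<in> span ?S" for h
  proof -
    have "C (h o\<^sub>L G) = regression_gain C G p ys (G (C (h o\<^sub>L G)))"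
      by (rule gainD[OF representing_sequence_gain[OF ys], symmetric])
    also have "\<dots> \<in> span ?S"
      unfolding regression_gain_apply by (intro span_sum span_scale span_base imageI)
    finally show ?thesis .
  qed
  then show thesis by (intro that[of ?S]) auto
qed

end

section \<open>Iterated conditioning\<close>

lemma has_finite_rankI:
  assumes "finite S" "\<And>h. R h \<in> span S"
  shows "has_finite_rank R (dim (range R))"
  using assms unfolding has_finite_rank_def by blast

lemma comp_blinfun_pair:
  "h o\<^sub>L blinfun_pair G1 G2
    = ((h o\<^sub>L blinfun_pair id_blinfun 0) o\<^sub>L G1) + ((h o\<^sub>L blinfun_pair 0 id_blinfun) o\<^sub>L G2)"
proof (rule blinfun_eqI)
  fix x
  show "(h o\<^sub>L blinfun_pair G1 G2) x
      = (((h o\<^sub>L blinfun_pair id_blinfun 0) o\<^sub>L G1) + ((h o\<^sub>L blinfun_pair 0 id_blinfun) o\<^sub>L G2)) x"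
    using blinfun.add_right[of h "(G1 x, 0)" "(0, G2 x)"]
    by (simp add: blinfun_pair.rep_eq blinfun.add_left)
qed

text \<open>The effect of two successive updates: the second observation is compared with its prediction
\<open>G2 (L1 y1)\<close> from the first one, and only the difference is processed by \<open>L2\<close>.\<close>

definition sequential_gain :: "('x::real_normed_vector \<Rightarrow>\<^sub>L 'y2::real_normed_vector) \<Rightarrow>
    ('y1::real_normed_vector \<Rightarrow>\<^sub>L 'x) \<Rightarrow> ('y2 \<Rightarrow>\<^sub>L 'x) \<Rightarrow> ('y1 \<times> 'y2) \<Rightarrow>\<^sub>L 'x" where
  "sequential_gain G2 L1 L2
    = (L1 o\<^sub>L fst_blinfun) + (L2 o\<^sub>L (snd_blinfun - (G2 o\<^sub>L L1 o\<^sub>L fst_blinfun)))"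

lemma sequential_gain_apply:
  "sequential_gain G2 L1 L2 y = L1 (fst y) + L2 (snd y - G2 (L1 (fst y)))"
  by (simp add: sequential_gain_def blinfun.add_left blinfun.diff_left)

context gaussian
begin

text \<open>The gain condition for the pair is linear in the functional, so it suffices to check it on
\<open>h1 \<circ> G1\<close>, where \<open>L1\<close> is already exact and \<open>L2\<close> receives zero, and on \<open>h2 \<circ> G2\<close>, where \<open>L2\<close>
supplies exactly what the covariance after the first update retains.\<close>

lemma is_gain_sequential_gain:
  fixes G1 :: "'x \<Rightarrow>\<^sub>L 'y1::{banach,second_countable_topology}"
    and G2 :: "'x \<Rightarrow>\<^sub>L 'y2::{banach,second_countable_topology}"
  assumes L1: "is_gain C G1 L1" and L2: "is_gain (\<lambda>g. C g - L1 (G1 (C g))) G2 L2"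
  shows "is_gain C (blinfun_pair G1 G2) (sequential_gain G2 L1 L2)"
  unfolding is_gain_def
proof
  fix h :: "('y1 \<times> 'y2) \<Rightarrow>\<^sub>L real"
  define h1 where "h1 = h o\<^sub>L blinfun_pair id_blinfun 0"
  define h2 where "h2 = h o\<^sub>L blinfun_pair 0 id_blinfun"
  let ?L = "sequential_gain G2 L1 L2" and ?P = "blinfun_pair G1 G2"
  have h: "h o\<^sub>L ?P = (h1 o\<^sub>L G1) + (h2 o\<^sub>L G2)" unfolding h1_def h2_def by (rule comp_blinfun_pair)
  have L: "?L (?P z) = L1 (G1 z) + L2 (G2 (z - L1 (G1 z)))" for z
    by (simp add: sequential_gain_apply blinfun_pair.rep_eq blinfun.diff_right)
  have 1: "?L (?P (C (h1 o\<^sub>L G1))) = C (h1 o\<^sub>L G1)"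
    by (simp add: L gainD[OF L1])
  have 2: "?L (?P (C (h2 o\<^sub>L G2))) = C (h2 o\<^sub>L G2)"
    using L2 by (simp add: L is_gain_def conj_operator_def)
  show "?L (conj_operator ?P C h) = C (h o\<^sub>L ?P)"
    by (simp add: conj_operator_def h blinfun.add_right 1 2)
qed

lemma posterior_posterior:
  fixes G1 :: "'x \<Rightarrow>\<^sub>L 'y1::{banach,second_countable_topology}"
    and G2 :: "'x \<Rightarrow>\<^sub>L 'y2::{banach,second_countable_topology}"
  shows "posterior (posterior \<mu> G1 L1 y1) G2 L2 y2
    = posterior \<mu> (blinfun_pair G1 G2) (sequential_gain G2 L1 L2) (y1, y2)"
proof -
  have "(\<lambda>x. x + L2 (y2 - G2 x)) \<in> borel_measurable borel"
    using update_measurable[of L2 y2 G2] by simp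
  then have "posterior (posterior \<mu> G1 L1 y1) G2 L2 y2
      = distr \<mu> borel ((\<lambda>x. x + L2 (y2 - G2 x)) \<circ> (\<lambda>x. x + L1 (y1 - G1 x)))"
    unfolding posterior_def by (intro distr_distr update_measurable)
  also have "(\<lambda>x. x + L2 (y2 - G2 x)) \<circ> (\<lambda>x. x + L1 (y1 - G1 x))
      = (\<lambda>x. x + sequential_gain G2 L1 L2 ((y1, y2) - blinfun_pair G1 G2 x))"
    by (auto simp: sequential_gain_apply blinfun_pair.rep_eq blinfun.add_right blinfun.diff_right algebra_simps)
  finally show ?thesis by (simp add: posterior_def)
qed

end

theorem theorem7:
  fixes \<mu> :: "'x::{banach,second_countable_topology} measure"
    and m :: 'x
    and C :: "('x \<Rightarrow>\<^sub>L real) \<Rightarrow> 'x"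
    and G1 :: "'x \<Rightarrow>\<^sub>L 'y1::{banach,second_countable_topology}"
    and G2 :: "'x \<Rightarrow>\<^sub>L 'y2::{banach,second_countable_topology}"
    and p1 p2 :: nat
  assumes "gaussian_measure \<mu>"
    and "is_mean_element \<mu> m"
    and "is_covariance_operator \<mu> C"
    and "has_finite_rank (conj_operator G1 C) p1"
    and "has_finite_rank (conj_operator G2 C) p2"
  shows
    "(\<exists>p ys. representing_sequence \<mu> (blinfun_pair G1 G2) p ys) \<and>
     (\<exists>ys1. representing_sequence \<mu> G1 p1 ys1) \<and>
     (\<forall>ys1. representing_sequence \<mu> G1 p1 ys1 \<longrightarrow>
        (\<exists>q zs. \<forall>y1. representing_sequence (conditional \<mu> G1 p1 ys1 y1) G2 q zs)) \<and>
     (\<forall>p ys ys1 q zs.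
        representing_sequence \<mu> (blinfun_pair G1 G2) p ys \<longrightarrow>
        representing_sequence \<mu> G1 p1 ys1 \<longrightarrow>
        (\<forall>y1. representing_sequence (conditional \<mu> G1 p1 ys1 y1) G2 q zs) \<longrightarrow>
        (AE (y1, y2) in distr \<mu> borel (blinfun_apply (blinfun_pair G1 G2)).
           conditional \<mu> (blinfun_pair G1 G2) p ys (y1, y2) =
           conditional (conditional \<mu> G1 p1 ys1 y1) G2 q zs y2))"
proof -
  interpret gaussian \<mu> m C using assms(1-3) by (rule gaussian.intro)
  let ?P = "blinfun_pair G1 G2"
  obtain S1 where S1: "finite S1" "\<And>h. C (h o\<^sub>L G1) \<in> span S1"
    using finite_rank_span[OF assms(4)] by blast
  obtain S2 where S2: "finite S2" "\<And>h. C (h o\<^sub>L G2) \<in> span S2"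
    using finite_rank_span[OF assms(5)] by blast
  have conditional1: "conditional \<mu> G1 p1 ys1 y1 = posterior \<mu> G1 (regression_gain C G1 p1 ys1) y1"
    and gaussian1: "gaussian (conditional \<mu> G1 p1 ys1 y1) (m + regression_gain C G1 p1 ys1 (y1 - G1 m))
      (\<lambda>g. C g - regression_gain C G1 p1 ys1 (G1 (C g)))"
    if "representing_sequence \<mu> G1 p1 ys1" for ys1 y1
    using that by (simp_all add: conditional_eq_posterior gaussian_posterior representing_sequence_gain)
  show ?thesis
  proof (intro conjI allI impI)
    have "conj_operator ?P C h \<in> span (blinfun_apply ?P ` (S1 \<union> S2))" for h
    proof -
      have "C (h o\<^sub>L ?P) \<in> span (S1 \<union> S2)"
        unfolding comp_blinfun_pair[of h G1 G2] C_linear(1)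
        using S1(2) S2(2) span_mono[of S1 "S1 \<union> S2"] span_mono[of S2 "S1 \<union> S2"]
        by (intro span_add) auto
      then show ?thesis
        by (simp add: conj_operator_def linear_span_image bounded_linear.linear[OF blinfun.bounded_linear_right])
    qed
    then have "has_finite_rank (conj_operator ?P C) (dim (range (conj_operator ?P C)))"
      by (rule has_finite_rankI[rotated]) (simp add: S1(1) S2(1))
    from exists_representing_sequence[OF this]
    show "\<exists>p ys. representing_sequence \<mu> ?P p ys" by blast
    show "\<exists>ys1. representing_sequence \<mu> G1 p1 ys1"
      by (rule exists_representing_sequence[OF assms(4)])
  next
    fix ys1 assume ys1: "representing_sequence \<mu> G1 p1 ys1"
    let ?L1 = "regression_gain C G1 p1 ys1"
    let ?C1 = "\<lambda>g. C g - ?L1 (G1 (C g))"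
    \<comment> \<open>The operator \<open>G2 C1 G2\<^sup>*\<close> factors through \<open>C G2\<^sup>*\<close>, so it has finite rank.\<close>
    let ?A = "G2 - (G2 o\<^sub>L ?L1 o\<^sub>L G1)"
    have "conj_operator G2 ?C1 h = ?A (C (h o\<^sub>L G2))" for h
      by (simp add: conj_operator_def blinfun.diff_left blinfun.diff_right)
    then have "conj_operator G2 ?C1 h \<in> span (blinfun_apply ?A ` S2)" for h
      using S2(2)[of h]
      by (simp add: linear_span_image bounded_linear.linear[OF blinfun.bounded_linear_right])
    then have rank: "has_finite_rank (conj_operator G2 ?C1) (dim (range (conj_operator G2 ?C1)))"
      by (rule has_finite_rankI[rotated]) (simp add: S2(1))
    obtain q where q: "q = dim (range (conj_operator G2 ?C1))" by blast
    from gaussian.exists_representing_sequence[OF gaussian1[OF ys1, of 0] rank]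
    obtain zs where "representing_sequence (conditional \<mu> G1 p1 ys1 0) G2 q zs" unfolding q by blast
    then have "representing_sequence (conditional \<mu> G1 p1 ys1 y1) G2 q zs" for y1
      by (simp add: representing_sequence_def gaussian.covariance_operator[OF gaussian1[OF ys1]])
    then show "\<exists>q zs. \<forall>y1. representing_sequence (conditional \<mu> G1 p1 ys1 y1) G2 q zs" by blast
  next
    fix p ys ys1 q zs
    assume ys: "representing_sequence \<mu> ?P p ys" and ys1: "representing_sequence \<mu> G1 p1 ys1"
      and zs: "\<forall>y1. representing_sequence (conditional \<mu> G1 p1 ys1 y1) G2 q zs"
    let ?L1 = "regression_gain C G1 p1 ys1"
    let ?C1 = "\<lambda>g. C g - ?L1 (G1 (C g))"
    let ?L2 = "regression_gain ?C1 G2 q zs"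
    let ?L = "regression_gain C ?P p ys"
    have L1: "is_gain C G1 ?L1" by (rule representing_sequence_gain[OF ys1])
    have L2: "is_gain ?C1 G2 ?L2"
      by (rule gaussian.representing_sequence_gain[OF gaussian1[OF ys1] zs[rule_format]])
    have L: "is_gain C ?P ?L" by (rule representing_sequence_gain[OF ys])
    have iterated: "conditional (conditional \<mu> G1 p1 ys1 y1) G2 q zs y2
        = posterior \<mu> ?P (sequential_gain G2 ?L1 ?L2) (y1, y2)" for y1 y2
      using gaussian.conditional_eq_posterior[OF gaussian1[OF ys1] zs[rule_format], of y1]
      by (simp add: conditional1[OF ys1] posterior_posterior)
    have "AE y in distr \<mu> borel ?P. posterior \<mu> ?P ?L y = posterior \<mu> ?P (sequential_gain G2 ?L1 ?L2) y"
      by (rule AE_posterior_eq[OF L is_gain_sequential_gain[OF L1 L2]])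
    then show "AE (y1, y2) in distr \<mu> borel (blinfun_apply ?P).
        conditional \<mu> ?P p ys (y1, y2) = conditional (conditional \<mu> G1 p1 ys1 y1) G2 q zs y2"
      by (simp add: case_prod_beta iterated conditional_eq_posterior[OF ys])
  qed
qed

end
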